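(* Let $(W,S)$ be an irreducible Coxeter system of rank $n>2$ and let $\mathsf{w}\in S^*$ be a reduced expression for an element $w\in\mathrm{CFC}(W)$ with full support. Then the expression $\mathsf{w}^k$ (the concatenation of $k$ copies of $\mathsf{w}$) is FC for all $k\in\mathbb{N}$ if and only if $w$ has no bands.
   Context: $(W,S)$ is a Coxeter system of finite rank $n=|S|$: $W=\langle S\mid (st)^{m(s,t)}=1\rangle$, where $m(s,t)=m(t,s)\in\{1,2,\dots,\infty\}$, $m(s,t)=1$ iff $s=t$, and $m(s,t)=\infty$ means no relation. The Coxeter graph has vertex set $S$ and an edge $\{s,t\}$ labeled $m(s,t)$ whenever $m(s,t)\ge 3$; $(W,S)$ is irreducible if this graph is connected. $\mathbb{N}=\{1,2,\dots\}$. $S^*$ is the free monoid on $S$; a word representing $w$ is an expression for $w$, and it is reduced if it has minimal length among all expressions for $w$. The support $\mathrm{supp}(w)$ is the set of generators occurring in any reduced expression of $w$; $w$ has full support if $\mathrm{supp}(w)=S$. "Subword" means consecutive subword. $\langle s,t\rangle_m=stst\cdots\in S^*$ ($m$ letters, starting with $s$). Two words are commutation equivalent if they differ by a sequence of moves $st\leftrightarrow ts$ with $m(s,t)=2$. An element $w\in W$ is fully commutative (FC) if all its reduced expressions are commutation equivalent; a word is called FC if it is a reduced expression for an FC element. A cyclic shift of a word is any word obtained by repeatedly moving the first letter to the end. $w$ is cyclically fully commutative (CFC), written $w\in\mathrm{CFC}(W)$, if every cyclic shift of every reduced expression for $w$ is a reduced expression for an FC element. An endpoint of a Coxeter graph is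 a vertex $s$ of degree $1$; its weight is $m(s,t)$ for the unique $t$ adjacent to it, and it is odd if this weight is a (finite) odd number. Bands: let $w\in\mathrm{CFC}(W)$ and let $(W',S')$ be the Coxeter system generated by $S'=\mathrm{supp}(w)$. For distinct $s,t\in S'$, exactly one of which is an odd endpoint of (the Coxeter graph of) $(W',S')$, $w$ has an $st$-band if for some reduced expression $\mathsf{u}$ of $w$: (1) some cyclic shift of $\mathsf{u}$ is commutation equivalent to a reduced expression containing $\langle s,t\rangle_{m(s,t)-1}$ as a subword; and (2) neither $s$ nor $t$ appears elsewhere in $\mathsf{u}$. $w$ has a band if it has an $st$-band for some ordered pair $(s,t)$. *)

theory Defs
  imports
    "HOL-Algebra.Generated_Groups"
    "HOL-Library.Extended_Nat"
    "HOL-Library.Sublist"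
begin

text \<open>
  Generators are elements of the group \<open>W\<close> itself, words are lists over the generating set
  \<open>S\<close>, and \<open>m s t = \<infinity>\<close> means that there is no relation between \<open>s\<close> and \<open>t\<close>.
\<close>

definition coxeter_matrix :: "'g set \<Rightarrow> ('g \<Rightarrow> 'g \<Rightarrow> enat) \<Rightarrow> bool" where
  "coxeter_matrix S m \<longleftrightarrow>
     (\<forall>s\<in>S. \<forall>t\<in>S. m s t = m t s \<and> m s t \<ge> 1 \<and> (m s t = 1 \<longleftrightarrow> s = t))"

inductive relator_move :: "'g set \<Rightarrow> ('g \<Rightarrow> 'g \<Rightarrow> enat) \<Rightarrow> 'g list \<Rightarrow> 'g list \<Rightarrow> bool"
  for S m where
  "\<lbrakk>s \<in> S; t \<in> S; m s t = enat k\<rbrakk>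
     \<Longrightarrow> relator_move S m (x @ concat (replicate k [s, t]) @ y) (x @ y)"

definition word_value :: "('g, 'b) monoid_scheme \<Rightarrow> 'g list \<Rightarrow> 'g" where
  "word_value W u = foldr (mult W) u (one W)"

text \<open>
  The axiom \<open>presentation\<close> says that \<open>W\<close> is the monoid presented by the Coxeter relators.
  Since \<open>m s s = 1\<close> makes each generator its own inverse, this is also the group presented
  by them.
\<close>

locale coxeter_system = group W for W :: "('g, 'b) monoid_scheme" (structure) +
  fixes S :: "'g set" and m :: "'g \<Rightarrow> 'g \<Rightarrow> enat"
  assumes finite_rank: "finite S"
    and gens_closed: "S \<subseteq> carrier W"
    and gens_generate: "generate W S = carrier W"
    and matrix: "coxeter_matrix S m"
    and presentation: "\<And>u v. \<lbrakk>u \<in> lists S; v \<in> lists S\<rbrakk>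
          \<Longrightarrow> word_value W u = word_value W v \<longleftrightarrow> equivclp (relator_move S m) u v"

definition coxeter_graph :: "'g set \<Rightarrow> ('g \<Rightarrow> 'g \<Rightarrow> enat) \<Rightarrow> ('g \<times> 'g) set" where
  "coxeter_graph S m = {(s, t). s \<in> S \<and> t \<in> S \<and> m s t \<ge> 3}"

definition irreducible_system :: "'g set \<Rightarrow> ('g \<Rightarrow> 'g \<Rightarrow> enat) \<Rightarrow> bool" where
  "irreducible_system S m \<longleftrightarrow> (\<forall>s\<in>S. \<forall>t\<in>S. (s, t) \<in> (coxeter_graph S m)\<^sup>*)"

definition endpoint :: "'g set \<Rightarrow> ('g \<Rightarrow> 'g \<Rightarrow> enat) \<Rightarrow> 'g \<Rightarrow> bool" where
  "endpoint S m s \<longleftrightarrow> s \<in> S \<and> card (coxeter_graph S m `` {s}) = 1"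

definition odd_endpoint :: "'g set \<Rightarrow> ('g \<Rightarrow> 'g \<Rightarrow> enat) \<Rightarrow> 'g \<Rightarrow> bool" where
  "odd_endpoint S m s \<longleftrightarrow> endpoint S m s \<and>
     (\<exists>t k. (s, t) \<in> coxeter_graph S m \<and> m s t = enat k \<and> odd k)"

definition expression_for :: "('g, 'b) monoid_scheme \<Rightarrow> 'g set \<Rightarrow> 'g list \<Rightarrow> 'g \<Rightarrow> bool" where
  "expression_for W S u w \<longleftrightarrow> u \<in> lists S \<and> word_value W u = w"

definition reduced_expression_for ::
    "('g, 'b) monoid_scheme \<Rightarrow> 'g set \<Rightarrow> 'g list \<Rightarrow> 'g \<Rightarrow> bool" where
  "reduced_expression_for W S u w \<longleftrightarrow> expression_for W S u w \<and>
     (\<forall>v. expression_for W S v w \<longrightarrow> length u \<le> length v)"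

definition reduced_word :: "('g, 'b) monoid_scheme \<Rightarrow> 'g set \<Rightarrow> 'g list \<Rightarrow> bool" where
  "reduced_word W S u \<longleftrightarrow> reduced_expression_for W S u (word_value W u)"

text \<open>
  By Matsumoto's theorem all reduced expressions of \<open>w\<close> use the same generators.
\<close>

definition supp :: "('g, 'b) monoid_scheme \<Rightarrow> 'g set \<Rightarrow> 'g \<Rightarrow> 'g set" where
  "supp W S w = {s. \<exists>u. reduced_expression_for W S u w \<and> s \<in> set u}"

inductive commutation_move ::
    "'g set \<Rightarrow> ('g \<Rightarrow> 'g \<Rightarrow> enat) \<Rightarrow> 'g list \<Rightarrow> 'g list \<Rightarrow> bool"
  for S m where
  "\<lbrakk>s \<in> S; t \<in> S; m s t = 2\<rbrakk> \<Longrightarrow> commutation_move S m (x @ [s, t] @ y) (x @ [t, s] @ y)"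

definition commutation_equivalent ::
    "'g set \<Rightarrow> ('g \<Rightarrow> 'g \<Rightarrow> enat) \<Rightarrow> 'g list \<Rightarrow> 'g list \<Rightarrow> bool" where
  "commutation_equivalent S m = equivclp (commutation_move S m)"

definition FC ::
    "('g, 'b) monoid_scheme \<Rightarrow> 'g set \<Rightarrow> ('g \<Rightarrow> 'g \<Rightarrow> enat) \<Rightarrow> 'g set" where
  "FC W S m = {w \<in> carrier W. \<forall>u v.
     reduced_expression_for W S u w \<and> reduced_expression_for W S v w
       \<longrightarrow> commutation_equivalent S m u v}"

definition FC_word ::
    "('g, 'b) monoid_scheme \<Rightarrow> 'g set \<Rightarrow> ('g \<Rightarrow> 'g \<Rightarrow> enat) \<Rightarrow> 'g list \<Rightarrow> bool" where
  "FC_word W S m u \<longleftrightarrow> (\<exists>w\<in>FC W S m. reduced_expression_for W S u w)"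

definition cyclic_shift :: "'g list \<Rightarrow> 'g list \<Rightarrow> bool" where
  "cyclic_shift u v \<longleftrightarrow> (\<exists>i. v = rotate i u)"

definition CFC ::
    "('g, 'b) monoid_scheme \<Rightarrow> 'g set \<Rightarrow> ('g \<Rightarrow> 'g \<Rightarrow> enat) \<Rightarrow> 'g set" where
  "CFC W S m = {w \<in> carrier W. \<forall>u v.
     reduced_expression_for W S u w \<and> cyclic_shift u v \<longrightarrow> FC_word W S m v}"

text \<open>\<open>alternating s t k\<close> is the word \<open>stst\<dots>\<close> with \<open>k\<close> letters.\<close>

fun alternating :: "'g \<Rightarrow> 'g \<Rightarrow> nat \<Rightarrow> 'g list" where
  "alternating s t 0 = []"
| "alternating s t (Suc k) = s # alternating t s k"

text \<open>
  Cyclic shifts and commutation moves preserve the number of occurrences of each letter. Hence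
  the two \<open>count_list\<close> conditions say that the letters of the alternating subword of \<open>v\<close>
  account for all occurrences of \<open>s\<close> and \<open>t\<close> in \<open>u\<close>, i.e. neither appears elsewhere in \<open>u\<close>.
  The hypothesis on odd endpoints forces \<open>m s t\<close> to be finite (it is odd if \<open>s\<close>
  and \<open>t\<close> are adjacent, and 2 otherwise), so requiring \<open>m s t = enat k\<close> excludes nothing.
\<close>

definition has_st_band ::
    "('g, 'b) monoid_scheme \<Rightarrow> 'g set \<Rightarrow> ('g \<Rightarrow> 'g \<Rightarrow> enat) \<Rightarrow> 'g \<Rightarrow> 'g \<Rightarrow> 'g \<Rightarrow> bool" where
  "has_st_band W S m w s t \<longleftrightarrow>
     s \<in> supp W S w \<and> t \<in> supp W S w \<and> s \<noteq> t \<and>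
     (odd_endpoint (supp W S w) m s \<longleftrightarrow> \<not> odd_endpoint (supp W S w) m t) \<and>
     (\<exists>k u u' v. m s t = enat k \<and> reduced_expression_for W S u w \<and>
        cyclic_shift u u' \<and> commutation_equivalent S m u' v \<and> reduced_word W S v \<and>
        sublist (alternating s t (k - 1)) v \<and>
        count_list u s = count_list (alternating s t (k - 1)) s \<and>
        count_list u t = count_list (alternating s t (k - 1)) t)"

definition has_band ::
    "('g, 'b) monoid_scheme \<Rightarrow> 'g set \<Rightarrow> ('g \<Rightarrow> 'g \<Rightarrow> enat) \<Rightarrow> 'g \<Rightarrow> bool" where
  "has_band W S m w \<longleftrightarrow> (\<exists>s t. has_st_band W S m w s t)"

end

theory Submission
  imports Defs "HOL-Library.Multiset" Complex_Main
begin

text \<open>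
  A word is FC iff no word commutation equivalent to it contains \<open>ss\<close> or a full braid
  \<open>\<langle>s,t\<rangle>\<close> of length \<open>m s t \<ge> 3\<close>. If \<open>w\<close> has an \<open>st\<close>-band, then in two consecutive
  copies of a suitable cyclic shift the odd endpoint of \<open>{s, t}\<close>, which commutes with everything
  between the two alternating subwords, can be moved across to complete a braid. Conversely, take
  a shortest non-FC factor \<open>M\<close> of \<open>u u u \<dots>\<close>. By minimality \<open>M\<close> begins and ends with the first
  and last letter of the forbidden subword, and \<open>M\<close> is longer than \<open>u\<close> because all cyclic shifts
  of \<open>u\<close> are FC. So every generator occurs between each of these letters and its recurrence one
  period away, whence neither has a neighbour outside the forbidden subword. By irreducibility
  and \<open>n > 2\<close> the two letters coincide, the braid has odd length, and \<open>M\<close> has exactly one letter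
  more than \<open>u\<close>; deleting it leaves a band.
\<close>

section \<open>Commutation classes\<close>

text \<open>Only the presentation of \<open>W\<close> is given, so two facts about Coxeter groups
  have to be built from it. Exchange comes from a parity: how often a reflection occurs among the
  reflections of a word, modulo 2, depends only on the element. But exchange between
  \<open>s\<close> and \<open>t\<close> only produces some relation \<open>(st)^p = 1\<close>, while
  a braid has \<open>m s t\<close> letters. That \<open>m s t \<le> p\<close>, i.e. that the
  presentation does not make the order of \<open>st\<close> collapse, needs a representation of
  \<open>W\<close>.

  Commutation classes are handled through the projections of a word to pairs of non-commuting
  letters, which determine the class. They give cancellation, and they show that a letter lying
  between two occurrences of a neighbour stays between them in every equivalent word; this is what
  ties the period of the infinite word to the position of the forbidden subword. A second surplus
  letter in the shortest factor would make the other letter of the braid recur as well, although it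
  has a neighbour outside.\<close>

context coxeter_system
begin

abbreviation val :: "'g list \<Rightarrow> 'g" where "val \<equiv> word_value W"

abbreviation ceq :: "'g list \<Rightarrow> 'g list \<Rightarrow> bool" (infix "\<approx>" 50)
  where "u \<approx> v \<equiv> commutation_equivalent S m u v"

lemma m_sym: "s \<in> S \<Longrightarrow> t \<in> S \<Longrightarrow> m s t = m t s"
  and m_eq_1_iff: "s \<in> S \<Longrightarrow> t \<in> S \<Longrightarrow> m s t = 1 \<longleftrightarrow> s = t"
  and m_self: "s \<in> S \<Longrightarrow> m s s = 1"
  and m_ge_1: "s \<in> S \<Longrightarrow> t \<in> S \<Longrightarrow> m s t \<ge> 1"
  using matrix unfolding coxeter_matrix_def by auto

lemma m_ge_3_iff:
  assumes "s \<in> S" "t \<in> S"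
  shows "m s t \<ge> 3 \<longleftrightarrow> s \<noteq> t \<and> m s t \<noteq> 2"
proof (cases "m s t")
  case (enat k)
  then show ?thesis using m_eq_1_iff[OF assms] m_ge_1[OF assms]
    by (auto simp: numeral_eq_enat one_enat_def)
next
  case infinity
  then show ?thesis using m_eq_1_iff[OF assms] by auto
qed

lemma commute_neq: "s \<in> S \<Longrightarrow> t \<in> S \<Longrightarrow> m s t = 2 \<Longrightarrow> s \<noteq> t"
  using m_self by auto

lemma ceq_refl [simp]: "u \<approx> u"
  unfolding commutation_equivalent_def by simp

lemma ceq_sym: "u \<approx> v \<Longrightarrow> v \<approx> u"
  unfolding commutation_equivalent_def by (rule equivclp_sym)

lemma ceq_trans [trans]: "u \<approx> v \<Longrightarrow> v \<approx> z \<Longrightarrow> u \<approx> z"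
  unfolding commutation_equivalent_def by (rule equivclp_trans)

lemma ceq_swap: "\<lbrakk>s \<in> S; t \<in> S; m s t = 2\<rbrakk> \<Longrightarrow> x @ [s, t] @ y \<approx> x @ [t, s] @ y"
  unfolding commutation_equivalent_def
  by (intro r_into_equivclp commutation_move.intros)

lemma ceq_induct [consumes 1, case_names base swap]:
  assumes "u \<approx> v" "P u"
    and "\<And>x y s t. s \<in> S \<Longrightarrow> t \<in> S \<Longrightarrow> m s t = 2 \<Longrightarrow> P (x @ [s, t] @ y) \<Longrightarrow> P (x @ [t, s] @ y)"
  shows "P v"
  using assms(1) unfolding commutation_equivalent_def
proof (induction rule: equivclp_induct)
  case base
  show ?case by fact
next
  case (step y z)
  from step(2) show ?case
  proof
    assume "commutation_move S m y z"
    then show ?thesis using step(3) assms(3) by cases auto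
  next
    assume "commutation_move S m z y"
    then show ?thesis
    proof cases
      case (1 s t x y)
      then show ?thesis using step(3) assms(3)[of t s x y] m_sym[of s t] by simp
    qed
  qed
qed

lemma ceq_append: "u \<approx> v \<Longrightarrow> x @ u @ y \<approx> x @ v @ y"
proof (induction rule: ceq_induct)
  case base
  show ?case by simp
next
  case (swap x' y' s t)
  then have "x @ (x' @ [s, t] @ y') @ y \<approx> x @ (x' @ [t, s] @ y') @ y"
    using ceq_swap[of s t "x @ x'" "y' @ y"] by simp
  with swap show ?case by (blast intro: ceq_trans)
qed

lemma ceq_Cons: "u \<approx> v \<Longrightarrow> s # u \<approx> s # v"
  using ceq_append[of u v "[s]" "[]"] by simp

lemma ceq_rev: "u \<approx> v \<Longrightarrow> rev u \<approx> rev v"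
proof (induction rule: ceq_induct)
  case (swap x y s t)
  have "rev (x @ [s, t] @ y) \<approx> rev (x @ [t, s] @ y)"
    using ceq_swap[of t s "rev y" "rev x"] swap m_sym[of s t] by simp
  with swap show ?case by (blast intro: ceq_trans)
qed simp

lemma ceq_mset: "u \<approx> v \<Longrightarrow> mset u = mset v"
  by (induction rule: ceq_induct) auto

lemma ceq_set: "u \<approx> v \<Longrightarrow> set u = set v"
  using ceq_mset mset_eq_setD by blast

lemma ceq_length: "u \<approx> v \<Longrightarrow> length u = length v"
  using ceq_mset mset_eq_length by blast

lemma ceq_lists: "u \<approx> v \<Longrightarrow> u \<in> lists S \<longleftrightarrow> v \<in> lists S"
  using ceq_set by (simp add: in_lists_conv_set)

text \<open>A move swaps two distinct commuting letters, which are never both in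
  \<open>{s, t}\<close>. The case \<open>s = t\<close> is included and records the number of
  occurrences of \<open>s\<close>.\<close>

lemma ceq_filter:
  assumes "u \<approx> v" "s \<in> S" "t \<in> S" "m s t \<noteq> 2"
  shows "filter (\<lambda>x. x = s \<or> x = t) u = filter (\<lambda>x. x = s \<or> x = t) v"
  using assms(1)
proof (induction rule: ceq_induct)
  case (swap x y s' t')
  have "\<not> ((s' = s \<or> s' = t) \<and> (t' = s \<or> t' = t))"
    using swap(1-3) assms(2-4) commute_neq m_sym by metis
  with swap(4) show ?case by (cases "s' = s \<or> s' = t"; cases "t' = s \<or> t' = t") simp_all
qed simp

lemma ceq_subseq:
  assumes "u \<approx> v" "s \<in> S" "t \<in> S" "m s t \<noteq> 2" "subseq xs u" "set xs \<subseteq> {s, t}"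
  shows "subseq xs v"
proof -
  let ?P = "\<lambda>x. x = s \<or> x = t"
  have "subseq (filter ?P xs) (filter ?P u)"
    using assms(5) by (rule subseq_filter)
  moreover have "filter ?P xs = xs"
    using assms(6) by (auto intro: filter_True)
  ultimately have "subseq xs (filter ?P v)"
    using ceq_filter[OF assms(1-4)] by simp
  then show ?thesis using subseq_filter_left subseq_order.trans by blast
qed

lemma ceq_move_front:
  assumes "p \<in> S" "\<forall>q\<in>set x. q \<in> S \<and> m p q = 2"
  shows "x @ p # y \<approx> p # x @ y"
  using assms(2)
proof (induction x)
  case (Cons q x)
  then have "q # x @ p # y \<approx> q # p # x @ y" by (auto intro: ceq_Cons)
  also have "q # p # x @ y \<approx> p # q # x @ y"
    using ceq_swap[of q p "[]" "x @ y"] Cons.prems assms(1) m_sym[of p q] by simp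
  finally show ?case by simp
qed simp

lemma ceq_move_back:
  assumes "p \<in> S" "\<forall>q\<in>set x. q \<in> S \<and> m p q = 2"
  shows "y @ p # x \<approx> y @ x @ [p]"
  using ceq_append[OF ceq_sym[OF ceq_move_front[OF assms, of "[]"]], of y "[]"] by simp

text \<open>A letter \<open>q\<close> of \<open>z1\<close> not commuting with \<open>p\<close> would
  make the projection of \<open>z1 @ p # z2\<close> to \<open>{p, q}\<close> start with
  \<open>q\<close>, but that of \<open>p # u\<close> starts with \<open>p\<close>. The hypothesis
  speaks of projections because \<open>ceq_of_filter\<close> applies this before equivalence is
  known.\<close>

lemma commute_before_first:
  assumes "p \<in> S" "set z1 \<subseteq> S" "p \<notin> set z1"
    and "\<And>q. q \<in> S \<Longrightarrow> m p q \<noteq> 2 \<Longrightarrow>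
      filter (\<lambda>x. x = p \<or> x = q) (p # u) = filter (\<lambda>x. x = p \<or> x = q) (z1 @ p # z2)"
  shows "\<forall>q\<in>set z1. q \<in> S \<and> m p q = 2"
proof
  fix q assume q: "q \<in> set z1"
  then have qS: "q \<in> S" using assms(2) by blast
  have "m p q = 2"
  proof (rule ccontr)
    assume "m p q \<noteq> 2"
    then have eq: "p # filter (\<lambda>x. x = p \<or> x = q) u =
        filter (\<lambda>x. x = p \<or> x = q) z1 @ filter (\<lambda>x. x = p \<or> x = q) (p # z2)"
      using assms(4)[OF qS] by simp
    have "filter (\<lambda>x. x = p \<or> x = q) z1 \<noteq> []" using q by (auto simp: filter_empty_conv)
    then obtain r rs where r: "filter (\<lambda>x. x = p \<or> x = q) z1 = r # rs"
      by (cases "filter (\<lambda>x. x = p \<or> x = q) z1") blast+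
    with eq have "r = p" by simp
    then have "p \<in> set (filter (\<lambda>x. x = p \<or> x = q) z1)" unfolding r by simp
    with assms(3) show False by simp
  qed
  with qS show "q \<in> S \<and> m p q = 2" by blast
qed

lemma filter_eq_ConsD:
  "filter P (p # u) = filter P (p # v) \<Longrightarrow> filter P u = filter P v"
  by (simp split: if_splits)

text \<open>The first letter of \<open>u\<close> can be moved to the front of \<open>v\<close>, as
  everything before its first occurrence there commutes with it; deleting it on both sides leaves
  equal projections. This is the projection theorem for partially commutative monoids.\<close>

lemma ceq_of_filter:
  assumes "u \<in> lists S" "v \<in> lists S"
    and "\<And>s t. s \<in> S \<Longrightarrow> t \<in> S \<Longrightarrow> m s t \<noteq> 2 \<Longrightarrow>
      filter (\<lambda>x. x = s \<or> x = t) u = filter (\<lambda>x. x = s \<or> x = t) v"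
  shows "u \<approx> v"
  using assms
proof (induction u arbitrary: v rule: list.induct)
  case Nil
  have "s \<notin> set v" for s
  proof
    assume "s \<in> set v"
    then have "s \<in> S" using Nil by auto
    then have "filter (\<lambda>x. x = s \<or> x = s) v = []" using Nil.prems(3)[of s s] m_self by auto
    with \<open>s \<in> set v\<close> show False by (auto simp: filter_empty_conv)
  qed
  then have "v = []" by (cases v) auto
  then show ?case by simp
next
  case (Cons p u)
  then have p: "p \<in> S" by auto
  \<comment> \<open>The pair \<open>p, p\<close> is admissible since \<open>m p p = 1\<close>; its
    projection shows that \<open>p\<close> occurs in \<open>v\<close>.\<close>
  have "filter (\<lambda>x. x = p \<or> x = p) (p # u) = filter (\<lambda>x. x = p \<or> x = p) v"
    using Cons.prems(3)[of p p] p m_self by auto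
  then have "p \<in> set (filter (\<lambda>x. x = p \<or> x = p) v)"
    by (metis (mono_tags, lifting) filter.simps(2) list.set_intros(1))
  then have "p \<in> set v" by simp
  then obtain z1 z2 where v: "v = z1 @ p # z2" and p_z1: "p \<notin> set z1"
    by (meson split_list_first)
  have "set z1 \<subseteq> S" using Cons.prems(2) v by auto
  then have z1: "\<forall>q\<in>set z1. q \<in> S \<and> m p q = 2"
    by (rule commute_before_first[OF p _ p_z1]) (use Cons.prems(3) p v in blast)
  have *: "v \<approx> p # z1 @ z2" unfolding v using p z1 by (rule ceq_move_front)
  have "u \<approx> z1 @ z2"
  proof (rule Cons.IH)
    show "u \<in> lists S" "z1 @ z2 \<in> lists S" using Cons.prems v by auto
    fix s t assume st: "s \<in> S" "t \<in> S" "m s t \<noteq> 2"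
    then have "filter (\<lambda>x. x = s \<or> x = t) (p # u) = filter (\<lambda>x. x = s \<or> x = t) v"
      by (rule Cons.prems(3))
    also have "\<dots> = filter (\<lambda>x. x = s \<or> x = t) (p # z1 @ z2)"
      using ceq_filter[OF * st] .
    finally show "filter (\<lambda>x. x = s \<or> x = t) u = filter (\<lambda>x. x = s \<or> x = t) (z1 @ z2)"
      by (rule filter_eq_ConsD)
  qed
  then show ?case using * by (meson ceq_Cons ceq_sym ceq_trans)
qed

text \<open>Removing \<open>p\<close> affects both projections alike. A chain of moves would be of
  no direct help, since its intermediate words may start with other letters.\<close>

lemma ceq_cancel_Cons:
  assumes "p # u \<approx> p # v" "p # u \<in> lists S"
  shows "u \<approx> v"
proof (rule ceq_of_filter)
  show "u \<in> lists S" "v \<in> lists S"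
    using assms ceq_lists[OF assms(1)] by auto
  fix s t assume "s \<in> S" "t \<in> S" "m s t \<noteq> 2"
  then show "filter (\<lambda>x. x = s \<or> x = t) u = filter (\<lambda>x. x = s \<or> x = t) v"
    by (rule ceq_filter[OF assms(1), THEN filter_eq_ConsD])
qed

lemma ceq_cancel_first:
  assumes "p # u \<approx> z1 @ p # z2" "p # u \<in> lists S" "p \<notin> set z1"
  shows "u \<approx> z1 @ z2" "\<forall>q\<in>set z1. q \<in> S \<and> m p q = 2"
proof -
  have p: "p \<in> S" and z: "z1 @ p # z2 \<in> lists S" using assms ceq_lists[OF assms(1)] by auto
  show *: "\<forall>q\<in>set z1. q \<in> S \<and> m p q = 2"
  proof (rule commute_before_first)
    show "p \<in> S" "p \<notin> set z1" by fact+
    show "set z1 \<subseteq> S" using z by auto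
  qed (use ceq_filter[OF assms(1) p] in blast)
  have "p # u \<approx> p # z1 @ z2"
    using ceq_trans[OF assms(1) ceq_move_front[OF p *]] .
  then show "u \<approx> z1 @ z2" using assms(2) by (rule ceq_cancel_Cons)
qed

end

section \<open>The order of a product of two generators\<close>

lemma length_alternating [simp]: "length (alternating s t k) = k"
  by (induction k arbitrary: s t) auto

lemma set_alternating_subset: "set (alternating s t k) \<subseteq> {s, t}"
proof (induction k arbitrary: s t)
  case (Suc k)
  from Suc[of t s] show ?case by auto
qed simp

lemma alternating_append:
  "alternating s t (j + k) =
    alternating s t j @ (if even j then alternating s t k else alternating t s k)"
  by (induction j arbitrary: s t) auto

lemma alternating_snoc: "alternating s t (Suc k) = alternating s t k @ [if even k then s else t]"
  using alternating_append[of s t k 1] by (auto simp del: alternating.simps(2) simp: alternating.simps(2)[of _ _ 0])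

lemma rev_alternating:
  "rev (alternating s t k) = (if even k then alternating t s k else alternating s t k)"
proof (induction k)
  case (Suc k)
  then show ?case by (subst alternating_snoc) auto
qed simp

lemma alternating_double: "alternating s t (2 * k) = alternating s t k @ rev (alternating t s k)"
  using alternating_append[of s t k k] by (auto simp: rev_alternating mult_2)

lemma alternating_even: "alternating s t (2 * k) = concat (replicate k [s, t])"
  by (induction k) auto

text \<open>Shifting the index does not change a sum over a full period, so the recurrence sums to
  \<open>2 * X = d * X\<close>.\<close>

lemma sum_periodic_eq_0:
  fixes g :: "nat \<Rightarrow> real"
  assumes "\<And>i. g (i + 2) + g i = d * g (i + 1)" "\<And>i. g (i + k) = g i" "d \<noteq> 2"
  shows "(\<Sum>i<k. g i) = 0"
proof -
  have shift: "(\<Sum>i<k. h (Suc i)) = (\<Sum>i<k. h i)" if "\<And>i. h (i + k) = h i" for h :: "nat \<Rightarrow> real"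
    using sum.lessThan_Suc_shift[of h k] that[of 0] by simp
  have 1: "(\<Sum>i<k. g (Suc i)) = (\<Sum>i<k. g i)"
    by (rule shift) (rule assms)
  have 2: "(\<Sum>i<k. g (Suc (Suc i))) = (\<Sum>i<k. g (Suc i))"
    by (rule shift) (metis add_Suc assms(2))
  have "(\<Sum>i<k. g (Suc (Suc i)) + g i) = (\<Sum>i<k. d * g (Suc i))"
    using assms(1) by simp
  then have "2 * (\<Sum>i<k. g i) = d * (\<Sum>i<k. g i)"
    using 1 2 by (simp add: sum.distrib flip: sum_distrib_left)
  then show ?thesis using assms(3) by simp
qed

context coxeter_system
begin

section \<open>Values of words in \<open>W\<close>\<close>

lemma alternating_lists: "s \<in> S \<Longrightarrow> t \<in> S \<Longrightarrow> alternating s t k \<in> lists S"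
  using set_alternating_subset[of s t k] by auto

lemma gen_closed: "s \<in> S \<Longrightarrow> s \<in> carrier W"
  using gens_closed by blast

lemma val_Nil [simp]: "val [] = \<one>"
  and val_Cons [simp]: "val (s # u) = s \<otimes> val u"
  by (simp_all add: word_value_def)

lemma val_closed [simp]: "u \<in> lists S \<Longrightarrow> val u \<in> carrier W"
  by (induction u rule: list.induct) (auto simp: gen_closed)

lemma val_append: "u \<in> lists S \<Longrightarrow> v \<in> lists S \<Longrightarrow> val (u @ v) = val u \<otimes> val v"
  by (induction u rule: list.induct) (auto simp: gen_closed m_assoc)

lemma val_relator:
  assumes "s \<in> S" "t \<in> S" "m s t = enat k"
  shows "val (alternating s t (2 * k)) = \<one>"
proof -
  have "relator_move S m (alternating s t (2 * k)) []"
    using relator_move.intros[of s S t m k "[]" "[]"] assms by (simp add: alternating_even)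
  then have "val (alternating s t (2 * k)) = val []"
    using presentation[of _ "[]"] alternating_lists[OF assms(1,2)] by blast
  then show ?thesis by simp
qed

lemma gen_square: "s \<in> S \<Longrightarrow> s \<otimes> s = \<one>"
  using val_relator[of s s 1] m_self[of s] by (simp add: one_enat_def numeral_2_eq_2 gen_closed)

lemma gen_inv: "s \<in> S \<Longrightarrow> inv s = s"
  using gen_square gen_closed inv_equality by blast

lemma gen_cancel [simp]: "s \<in> S \<Longrightarrow> g \<in> carrier W \<Longrightarrow> s \<otimes> (s \<otimes> g) = g"
  using gen_square[of s] gen_closed m_assoc[of s s g] by simp

lemma rev_lists [simp]: "rev u \<in> lists S \<longleftrightarrow> u \<in> lists S"
  unfolding in_lists_conv_set by simp

lemma val_rev: "u \<in> lists S \<Longrightarrow> val (rev u) \<otimes> val u = \<one>"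
proof (induction u rule: list.induct)
  case (Cons s u)
  then have su: "s \<in> S" "u \<in> lists S" by auto
  then have "val (rev (s # u)) = val (rev u) \<otimes> s"
    by (simp add: val_append gen_closed)
  then have "val (rev (s # u)) \<otimes> val (s # u) = val (rev u) \<otimes> (s \<otimes> (s \<otimes> val u))"
    using su by (simp add: m_assoc gen_closed del: gen_cancel)
  with Cons.IH su show ?case by simp
qed simp

text \<open>\<open>alternating s t k\<close> followed by the reverse of
  \<open>alternating t s k\<close> is the relator, and a reversed word represents the
  inverse.\<close>

lemma val_alternating_swap:
  assumes "s \<in> S" "t \<in> S" "m s t = enat k"
  shows "val (alternating s t k) = val (alternating t s k)"
proof -
  let ?a = "alternating s t k" and ?b = "alternating t s k"
  have ab: "?a \<in> lists S" "?b \<in> lists S"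
    using assms alternating_lists by blast+
  have "val ?a = val ?a \<otimes> (val (rev ?b) \<otimes> val ?b)" using ab by (simp add: val_rev)
  also have "\<dots> = val (alternating s t (2 * k)) \<otimes> val ?b"
    using ab by (simp add: alternating_double val_append m_assoc)
  also have "\<dots> = val ?b" using ab by (simp add: val_relator[OF assms])
  finally show ?thesis .
qed

text \<open>This is \<open>-2\<close> times the canonical bilinear form on simple roots:
  \<open>m s s = 1\<close> makes the diagonal \<open>-2\<close>, and \<open>\<infinity>\<close>
  stands for the form value \<open>-1\<close>.\<close>

definition coef :: "'g \<Rightarrow> 'g \<Rightarrow> real" where
  "coef s t = (case m s t of enat k \<Rightarrow> 2 * cos (pi / real k) | \<infinity> \<Rightarrow> 2)"

text \<open>
  The geometric representation of \<open>W\<close>, in its dual form (Mozes' numbers game): it serves only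
  to show that \<open>st\<close> has order no smaller than \<open>m s t\<close>.
\<close>

definition fire :: "'g \<Rightarrow> ('g \<Rightarrow> real) \<Rightarrow> 'g \<Rightarrow> real" where
  "fire s f = (\<lambda>x. f x + coef s x * f s)"

lemma coef_self: "s \<in> S \<Longrightarrow> coef s s = - 2"
  using m_self[of s] by (simp add: coef_def one_enat_def)

lemma coef_sym: "s \<in> S \<Longrightarrow> t \<in> S \<Longrightarrow> coef s t = coef t s"
  using m_sym[of s t] by (simp add: coef_def)

text \<open>Firing \<open>s\<close> and \<open>t\<close> in turn runs through a solution
  \<open>b\<close> of a linear recurrence: \<open>b (2 * i + 1)\<close> is the value fired at
  \<open>s\<close> and \<open>b (2 * i + 2)\<close> the one fired at \<open>t\<close>. Each
  \<open>x\<close> accumulates these values with weights \<open>coef s x\<close> and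
  \<open>coef t x\<close>.\<close>

lemma fold_fire_alternating:
  assumes "s \<in> S" "t \<in> S"
    and "\<And>n. b (n + 2) = coef s t * b (n + 1) - b n" "f s = b 1" "f t = - b 0"
  shows "fold fire (alternating s t (2 * p)) f =
      (\<lambda>x. f x + coef s x * (\<Sum>i<p. b (2 * i + 1)) + coef t x * (\<Sum>i<p. b (2 * i + 2)))
    \<and> fold fire (alternating s t (2 * p)) f s = b (2 * p + 1)
    \<and> fold fire (alternating s t (2 * p)) f t = - b (2 * p)"
proof (induction p)
  case 0
  show ?case using assms by simp
next
  case (Suc p)
  define F where "F = fold fire (alternating s t (2 * p)) f"
  have F: "F s = b (2 * p + 1)" "F t = - b (2 * p)"
    using Suc unfolding F_def by blast+
  have two: "2 * Suc p = 2 * p + Suc (Suc 0)" by simp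
  have "alternating s t (2 * Suc p) = alternating s t (2 * p) @ [s, t]"
    unfolding two by (subst alternating_append) simp
  then have *: "fold fire (alternating s t (2 * Suc p)) f = fire t (fire s F)"
    by (simp add: F_def)
  have t: "fire s F t = b (2 * p + 2)"
    using F assms(3)[of "2 * p"] by (simp add: fire_def)
  have s: "fire s F s = - b (2 * p + 1)"
    using F coef_self[OF assms(1)] by (simp add: fire_def)
  have "fire t (fire s F) s = b (2 * p + 3)"
    using s t assms(3)[of "2 * p + 1"] coef_sym[OF assms(1,2)]
    by (simp add: fire_def[of t] add.commute numeral_eq_Suc)
  moreover have "fire t (fire s F) t = - b (2 * p + 2)"
    using t coef_self[OF assms(2)] by (simp add: fire_def[of t])
  moreover have "fire t (fire s F) =
      (\<lambda>x. f x + coef s x * (\<Sum>i<Suc p. b (2 * i + 1)) + coef t x * (\<Sum>i<Suc p. b (2 * i + 2)))"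
  proof
    fix x
    have "fire t (fire s F) x = F x + coef s x * b (2 * p + 1) + coef t x * b (2 * p + 2)"
      using t F by (simp add: fire_def)
    also have "F x = f x + coef s x * (\<Sum>i<p. b (2 * i + 1)) + coef t x * (\<Sum>i<p. b (2 * i + 2))"
      using Suc unfolding F_def by metis
    finally show "fire t (fire s F) x =
      f x + coef s x * (\<Sum>i<Suc p. b (2 * i + 1)) + coef t x * (\<Sum>i<Suc p. b (2 * i + 2))"
      by (simp add: algebra_simps)
  qed
  ultimately show ?case unfolding * by (simp add: numeral_eq_Suc)
qed

text \<open>For \<open>s \<noteq> t\<close> both sums in \<open>fold_fire_alternating\<close> with
  \<open>p = k\<close> run over a full period and vanish. Hence firing respects the
  relators.\<close>

lemma fold_fire_relator:
  assumes "s \<in> S" "t \<in> S" "m s t = enat k"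
  shows "fold fire (alternating s t (2 * k)) f = f"
proof (cases "s = t")
  case True
  then have "k = 1" using assms m_self[of s] by (simp add: one_enat_def)
  with True show ?thesis using coef_self[OF assms(1)]
    by (auto simp: fire_def numeral_2_eq_2)
next
  case False
  have k: "k \<ge> 2" using m_ge_1[OF assms(1,2)] m_eq_1_iff[OF assms(1,2)] assms(3) False
    by (auto simp: one_enat_def)
  define \<theta> where "\<theta> = pi / real k"
  have \<theta>: "real k * \<theta> = pi" using k by (simp add: \<theta>_def)
  have "0 < \<theta>" "\<theta> < pi" using k by (auto simp: \<theta>_def field_simps)
  then have sin: "sin \<theta> \<noteq> 0" using sin_gt_zero by force
  have c: "coef s t = 2 * cos \<theta>" using assms(3) by (simp add: coef_def \<theta>_def)
  \<comment> \<open>The solution of the recurrence with \<open>b 1 = f s\<close> and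
    \<open>b 0 = - f t\<close>.\<close>
  define b where "b n = (f s * sin (real n * \<theta>) + f t * sin (real n * \<theta> - \<theta>)) / sin \<theta>" for n
  have rec: "b (n + 2) = coef s t * b (n + 1) - b n" for n
  proof -
    have *: "sin (x + \<theta>) = 2 * cos \<theta> * sin x - sin (x - \<theta>)" for x
      by (simp add: sin_add sin_diff)
    have s1: "sin (real (n + 2) * \<theta>) = 2 * cos \<theta> * sin (real (n + 1) * \<theta>) - sin (real n * \<theta>)"
      using *[of "real (n + 1) * \<theta>"] by (simp add: algebra_simps)
    have s2: "sin (real (n + 2) * \<theta> - \<theta>) =
        2 * cos \<theta> * sin (real (n + 1) * \<theta> - \<theta>) - sin (real n * \<theta> - \<theta>)"
      using *[of "real n * \<theta>"] by (simp add: algebra_simps)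
    show ?thesis unfolding b_def c s1 s2
      by (simp add: diff_divide_distrib add_divide_distrib algebra_simps)
  qed
  have period: "b (n + 2 * k) = b n" for n
  proof -
    have *: "real (n + 2 * k) * \<theta> = real n * \<theta> + 2 * pi"
      using \<theta> by (simp add: algebra_simps)
    have "sin (real n * \<theta> + 2 * pi - \<theta>) = sin (real n * \<theta> - \<theta>)"
      using sin_periodic[of "real n * \<theta> - \<theta>"] by (simp add: algebra_simps)
    then show ?thesis unfolding b_def * by simp
  qed
  \<comment> \<open>Taking every second term of \<open>b\<close> gives a recurrence with coefficient
    \<open>d = 2 * cos (2 * \<theta>)\<close>, which is not \<open>2\<close> because
    \<open>sin \<theta> \<noteq> 0\<close>.\<close>
  define d where "d = (coef s t)\<^sup>2 - 2"
  have "(sin \<theta>)\<^sup>2 \<noteq> 0" using sin by simp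
  then have "d \<noteq> 2" unfolding d_def c by (simp add: power_mult_distrib cos_squared_eq)
  have rec2: "b (n + 4) + b n = d * b (n + 2)" for n
  proof -
    have r: "b (n + 4) = coef s t * b (n + 3) - b (n + 2)" "b (n + 3) = coef s t * b (n + 2) - b (n + 1)"
      "b n = coef s t * b (n + 1) - b (n + 2)"
      using rec[of n] rec[of "n + 1"] rec[of "n + 2"] by (simp_all add: numeral_eq_Suc)
    show ?thesis unfolding r d_def by (simp add: algebra_simps power2_eq_square)
  qed
  have odd: "(\<Sum>i<k. b (2 * i + 1)) = 0"
  proof (rule sum_periodic_eq_0[OF _ _ \<open>d \<noteq> 2\<close>])
    show "b (2 * (i + 2) + 1) + b (2 * i + 1) = d * b (2 * (i + 1) + 1)" for i
      using rec2[of "2 * i + 1"] by (simp add: numeral_eq_Suc)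
    show "b (2 * (i + k) + 1) = b (2 * i + 1)" for i
      using period[of "2 * i + 1"] by (simp add: algebra_simps)
  qed
  have even: "(\<Sum>i<k. b (2 * i + 2)) = 0"
  proof (rule sum_periodic_eq_0[OF _ _ \<open>d \<noteq> 2\<close>])
    show "b (2 * (i + 2) + 2) + b (2 * i + 2) = d * b (2 * (i + 1) + 2)" for i
      using rec2[of "2 * i + 2"] by (simp add: numeral_eq_Suc)
    show "b (2 * (i + k) + 2) = b (2 * i + 2)" for i
      using period[of "2 * i + 2"] by (simp add: algebra_simps)
  qed
  have "f s = b 1" "f t = - b 0" using sin by (simp_all add: b_def)
  from fold_fire_alternating[OF assms(1,2), of b, OF rec this, of k] odd even
  show ?thesis by simp
qed

lemma val_eq_induct [consumes 3, case_names base insert delete]: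
  assumes "val u = val v" "u \<in> lists S" "v \<in> lists S"
    and "P u"
    and "\<And>x y s t k. \<lbrakk>x \<in> lists S; y \<in> lists S; s \<in> S; t \<in> S; m s t = enat k; P (x @ y)\<rbrakk>
      \<Longrightarrow> P (x @ alternating s t (2 * k) @ y)"
    and "\<And>x y s t k. \<lbrakk>x \<in> lists S; y \<in> lists S; s \<in> S; t \<in> S; m s t = enat k;
      P (x @ alternating s t (2 * k) @ y)\<rbrakk> \<Longrightarrow> P (x @ y)"
  shows "P v"
proof -
  have "equivclp (relator_move S m) u v" using presentation assms(1-3) by blast
  then have "v \<in> lists S \<and> P v"
  proof (induction rule: equivclp_induct)
    case base
    show ?case using assms by blast
  next
    case (step y z)
    from step(2) show ?case
    proof
      assume "relator_move S m y z"
      then show ?thesis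
      proof cases
        case (1 s t k x y')
        then have "x \<in> lists S" "y' \<in> lists S" using step(3) by auto
        with 1 step(3) assms(6)[of x y' s t k] show ?thesis by (simp add: alternating_even)
      qed
    next
      assume "relator_move S m z y"
      then show ?thesis
      proof cases
        case (1 s t k x y')
        then have xy: "x \<in> lists S" "y' \<in> lists S" using step(3) by auto
        with 1 alternating_lists[of s t "2 * k"] have "z \<in> lists S"
          by (auto simp: alternating_even)
        with xy 1 step(3) assms(5)[of x y' s t k] show ?thesis by (simp add: alternating_even)
      qed
    qed
  qed
  then show ?thesis by blast
qed

lemma fold_fire_cong:
  assumes "val u = val v" "u \<in> lists S" "v \<in> lists S"
  shows "fold fire u = fold fire v"
  using assms
proof (induction rule: val_eq_induct)
  case (insert x y s t k)
  moreover have "fold fire (alternating s t (2 * k)) = id"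
    using fold_fire_relator[OF insert(3-5)] by auto
  ultimately show ?case by simp
next
  case (delete x y s t k)
  moreover have "fold fire (alternating s t (2 * k)) = id"
    using fold_fire_relator[OF delete(3-5)] by auto
  ultimately show ?case by simp
qed simp

text \<open>Words of equal value act equally by firing, so the word must fix every \<open>f\<close>;
  for \<open>p < m s t\<close> some \<open>f\<close> is moved.\<close>

lemma order_ge:
  assumes "s \<in> S" "t \<in> S" "s \<noteq> t" "p \<ge> 1" "val (alternating s t (2 * p)) = \<one>"
  shows "m s t \<le> enat p"
proof (rule ccontr)
  assume "\<not> m s t \<le> enat p"
  have id: "fold fire (alternating s t (2 * p)) f = f" for f
    using fold_fire_cong[of "alternating s t (2 * p)" "[]"] assms alternating_lists by simp
  show False
  proof (cases "m s t")
    case (enat k)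
    then have "p < k" using \<open>\<not> m s t \<le> enat p\<close> by simp
    define \<theta> where "\<theta> = pi / real k"
    \<comment> \<open>Chosen so that \<open>b 1 = 1\<close>; after \<open>2 * p\<close> firings the
      value at \<open>s\<close> is \<open>cos (2 * p * \<theta>)\<close>, which is \<open>1\<close>
      only if \<open>sin (p * \<theta>) = 0\<close>.\<close>
    define b where "b n = cos (real n * \<theta> - \<theta>)" for n
    define f where "f x = (if x = s then 1 else - cos \<theta>)" for x
    have c: "coef s t = 2 * cos \<theta>" using enat by (simp add: coef_def \<theta>_def)
    have "b (n + 2) = coef s t * b (n + 1) - b n" for n
    proof -
      have "cos (x + \<theta>) = 2 * cos \<theta> * cos x - cos (x - \<theta>)" for x
        by (simp add: cos_add cos_diff)
      from this[of "real n * \<theta>"] show ?thesis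
        unfolding b_def c by (simp add: algebra_simps)
    qed
    moreover have "f s = b 1" "f t = - b 0" using assms(3) by (auto simp: f_def b_def)
    ultimately have "fold fire (alternating s t (2 * p)) f s = b (2 * p + 1)"
      using fold_fire_alternating[OF assms(1,2), of b f] by blast
    then have "cos (2 * (real p * \<theta>)) = 1"
      using id[of f] by (simp add: f_def b_def algebra_simps)
    then have "sin (real p * \<theta>) = 0" by (simp add: cos_double_sin)
    moreover have "0 < real p * \<theta>" "real p * \<theta> < pi"
      using assms(4) \<open>p < k\<close> by (auto simp: \<theta>_def field_simps)
    ultimately show False using sin_gt_zero by force
  next
    case infinity
    \<comment> \<open>With coefficient \<open>2\<close> the recurrence is solved by
      \<open>b n = n\<close>, so the value at \<open>s\<close> never returns to
      \<open>1\<close>.\<close>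
    define f where "f x = (if x = s then 1 else 0 :: real)" for x
    have "fold fire (alternating s t (2 * p)) f s = real (2 * p + 1)"
      using fold_fire_alternating[OF assms(1,2), of real f p] infinity assms(3)
      by (auto simp: f_def coef_def)
    then show False using id[of f] assms(4) by (simp add: f_def)
  qed
qed

end

section \<open>Reflections and the exchange condition\<close>

lemma map_upt_periodic:
  assumes "\<And>j. h (j + k) = h j"
  shows "map h [0..<2 * k] = map h [0..<k] @ map h [0..<k]"
proof (rule nth_equalityI)
  fix i assume "i < length (map h [0..<2 * k])"
  then show "map h [0..<2 * k] ! i = (map h [0..<k] @ map h [0..<k]) ! i"
    using assms[of "i - k"] by (cases "i < k") (simp_all add: nth_append)
qed simp

lemma count_list_distinct: "distinct xs \<Longrightarrow> count_list xs r = (if r \<in> set xs then 1 else 0)"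
  by (induction xs) auto

lemma distinct_even_count_eq:
  assumes "distinct xs" "distinct ys" "\<And>r. r \<in> set xs \<union> set ys \<Longrightarrow> even (count_list xs r) = even (count_list ys r)"
  shows "set xs = set ys"
proof -
  have *: "even (count_list zs r) \<longleftrightarrow> r \<notin> set zs" if "distinct zs" for zs :: "'a list" and r
    using that by (simp add: count_list_distinct)
  show ?thesis using * assms by blast
qed

context coxeter_system
begin

text \<open>
  For a word \<open>s\<^sub>1 \<dots> s\<^sub>k\<close>, the reflections \<open>s\<^sub>1 \<dots> s\<^sub>i \<dots> s\<^sub>1\<close>.
\<close>

primrec refls :: "'g list \<Rightarrow> 'g list" where
  "refls [] = []"
| "refls (s # u) = s # map (\<lambda>r. s \<otimes> r \<otimes> inv s) (refls u)"

lemma length_refls [simp]: "length (refls u) = length u"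
  by (induction u) auto

lemma refls_closed: "u \<in> lists S \<Longrightarrow> set (refls u) \<subseteq> carrier W"
  by (induction u rule: list.induct) (auto simp: gen_closed)

lemma refls_append:
  "u \<in> lists S \<Longrightarrow> v \<in> lists S \<Longrightarrow>
    refls (u @ v) = refls u @ map (\<lambda>r. val u \<otimes> r \<otimes> inv (val u)) (refls v)"
proof (induction u rule: list.induct)
  case Nil
  then show ?case using refls_closed[of v] by (auto intro!: map_idI[symmetric])
next
  case (Cons s u)
  then have su: "s \<in> S" "u \<in> lists S" by auto
  have "s \<otimes> (val u \<otimes> r \<otimes> inv (val u)) \<otimes> inv s = s \<otimes> val u \<otimes> r \<otimes> inv (s \<otimes> val u)"
    if "r \<in> carrier W" for r
    using su that by (simp add: gen_closed m_assoc inv_mult_group)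
  with Cons su show ?case using refls_closed[of v] by auto
qed

text \<open>Conjugating an odd alternating word from \<open>t\<close> to \<open>t\<close> by
  \<open>s\<close> adds one \<open>s\<close> at each end.\<close>

lemma refls_alternating:
  assumes "s \<in> S" "t \<in> S"
  shows "refls (alternating s t n) = map (\<lambda>j. val (alternating s t (2 * j + 1))) [0..<n]"
  using assms
proof (induction n arbitrary: s t)
  case (Suc n)
  have "s \<otimes> val (alternating t s (2 * j + 1)) \<otimes> inv s = val (alternating s t (2 * Suc j + 1))" for j
  proof -
    define a where "a = alternating t s (2 * j + 1)"
    have a: "a \<in> lists S" unfolding a_def using Suc.prems by (intro alternating_lists)
    have len: "2 * Suc j + 1 = Suc (Suc (2 * j + 1))" by simp
    have "alternating s t (2 * Suc j + 1) = s # (a @ [s])"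
      unfolding len a_def alternating.simps(2)[of s t "Suc (2 * j + 1)"]
      by (subst alternating_snoc) simp
    then show ?thesis
      unfolding a_def[symmetric] using a Suc.prems by (simp add: val_append gen_inv m_assoc gen_closed)
  qed
  then have "refls (alternating s t (Suc n)) = val (alternating s t (2 * 0 + 1)) #
      map (\<lambda>j. val (alternating s t (2 * Suc j + 1))) [0..<n]"
    using Suc.IH[OF Suc.prems(2,1)] Suc.prems by (simp add: gen_closed comp_def del: mult_Suc_right)
  also have "\<dots> = map (\<lambda>j. val (alternating s t (2 * j + 1))) [0..<Suc n]"
    unfolding map_upt_Suc ..
  finally show ?case .
qed simp

text \<open>The expressions for entries \<open>j + k\<close> and \<open>j\<close> differ by a whole
  relator in front, so the second half of the list repeats the first.\<close>

lemma count_refl_relator: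
  assumes "s \<in> S" "t \<in> S" "m s t = enat k"
  shows "even (count_list (refls (alternating s t (2 * k))) r)"
proof -
  define h where "h j = val (alternating s t (2 * j + 1))" for j
  have "h (j + k) = h j" for j
  proof -
    define b where "b = alternating s t (2 * j + 1)"
    define q where "q = alternating s t (2 * k)"
    have bq: "b \<in> lists S" "q \<in> lists S" unfolding b_def q_def using assms by (simp_all only: alternating_lists)
    have len: "2 * (j + k) + 1 = 2 * k + (2 * j + 1)" by simp
    have "alternating s t (2 * (j + k) + 1) = q @ b"
      unfolding len alternating_append b_def q_def by simp
    moreover have "val q = \<one>" unfolding q_def by (rule val_relator[OF assms])
    ultimately show ?thesis unfolding h_def b_def[symmetric] using bq by (simp add: val_append)
  qed
  then have "map h [0..<2 * k] = map h [0..<k] @ map h [0..<k]"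
    by (rule map_upt_periodic)
  moreover have "refls (alternating s t (2 * k)) = map h [0..<2 * k]"
    unfolding h_def by (rule refls_alternating[OF assms(1,2)])
  ultimately have "refls (alternating s t (2 * k)) = map h [0..<k] @ map h [0..<k]"
    by (metis (no_types))
  then show ?thesis by simp
qed

lemma count_list_map_conj:
  assumes "g \<in> carrier W" "set xs \<subseteq> carrier W" "r \<in> carrier W"
  shows "count_list (map (\<lambda>r. g \<otimes> r \<otimes> inv g) xs) r = count_list xs (inv g \<otimes> r \<otimes> g)"
  using assms(2)
proof (induction xs)
  case (Cons x xs)
  have "g \<otimes> x \<otimes> inv g = r \<longleftrightarrow> x = inv g \<otimes> r \<otimes> g"
  proof -
    have x: "x \<in> carrier W" using Cons.prems by simp
    have "r = g \<otimes> x \<otimes> inv g \<longleftrightarrow> g \<otimes> x = r \<otimes> g"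
      using assms(1,3) x by (intro inv_solve_right) simp_all
    moreover have "x = inv g \<otimes> (r \<otimes> g) \<longleftrightarrow> r \<otimes> g = g \<otimes> x"
      using assms(1,3) x by (intro inv_solve_left) simp_all
    moreover have "inv g \<otimes> (r \<otimes> g) = inv g \<otimes> r \<otimes> g"
      using assms(1,3) by (simp add: m_assoc)
    ultimately show ?thesis by metis
  qed
  with Cons show ?case by simp
qed simp

text \<open>The relator has value one, so the reflections after it stay the same, and its own ones,
  conjugated by \<open>val x\<close>, occur an even number of times.\<close>

lemma count_refl_insert:
  assumes "x \<in> lists S" "y \<in> lists S" "s \<in> S" "t \<in> S" "m s t = enat k" "r \<in> carrier W"
  shows "even (count_list (refls (x @ alternating s t (2 * k) @ y)) r) = even (count_list (refls (x @ y)) r)"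
proof -
  let ?q = "alternating s t (2 * k)"
  have q: "?q \<in> lists S" using alternating_lists assms by blast
  have y: "map (\<lambda>r. \<one> \<otimes> r \<otimes> inv \<one>) (refls y) = refls y"
    using refls_closed[OF assms(2)] by (auto intro!: map_idI)
  have "refls (?q @ y) = refls ?q @ refls y"
    using q assms y by (simp add: refls_append val_relator[OF assms(3-5)])
  then have "refls (x @ ?q @ y) = refls x @ map (\<lambda>r. val x \<otimes> r \<otimes> inv (val x)) (refls ?q)
      @ map (\<lambda>r. val x \<otimes> r \<otimes> inv (val x)) (refls y)"
    using q assms by (subst refls_append) auto
  moreover have "even (count_list (map (\<lambda>r. val x \<otimes> r \<otimes> inv (val x)) (refls ?q)) r)"
    using assms q refls_closed[OF q] count_refl_relator[OF assms(3-5)] by (subst count_list_map_conj) auto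
  ultimately show ?thesis using assms by (simp add: refls_append)
qed

text \<open>For a reduced word the reflections of odd multiplicity are the inversions of the
  element; parity makes sense of them for every expression.\<close>

lemma refl_parity:
  assumes "val u = val v" "u \<in> lists S" "v \<in> lists S" "r \<in> carrier W"
  shows "even (count_list (refls u) r) = even (count_list (refls v) r)"
  using assms(1-3)
proof (induction rule: val_eq_induct)
  case (insert x y s t k)
  with count_refl_insert[OF insert(1-5) assms(4)] show ?case by blast
next
  case (delete x y s t k)
  with count_refl_insert[OF delete(1-5) assms(4)] show ?case by blast
qed simp

text \<open>With \<open>u = x s y\<close> and \<open>s\<close> at position \<open>i\<close>, the
  reflection is \<open>x s x^-1\<close>, and \<open>(x s x^-1) x s y = x y\<close>.\<close>

lemma refls_delete:
  assumes "u \<in> lists S" "i < length u"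
  shows "refls u ! i \<otimes> val u = val (take i u @ drop (Suc i) u)"
  using assms
proof (induction u arbitrary: i rule: list.induct)
  case (Cons s u)
  then have su: "s \<in> S" "u \<in> lists S" by auto
  show ?case
  proof (cases i)
    case 0
    then show ?thesis using su by simp
  next
    case (Suc j)
    then have j: "j < length u" using Cons by simp
    then have "refls u ! j \<in> carrier W" using refls_closed[OF su(2)] nth_mem[of j "refls u"] by auto
    then have "(s \<otimes> refls u ! j \<otimes> inv s) \<otimes> (s \<otimes> val u) = s \<otimes> (refls u ! j \<otimes> val u)"
      using su by (simp add: gen_inv m_assoc gen_closed)
    then show ?thesis using Cons.IH[OF su(2) j] Suc j by simp
  qed
qed simp

section \<open>Reduced words\<close>

abbreviation red :: "'g list \<Rightarrow> bool" where "red \<equiv> reduced_word W S"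

lemma red_iff: "red u \<longleftrightarrow> u \<in> lists S \<and> (\<forall>v\<in>lists S. val v = val u \<longrightarrow> length u \<le> length v)"
  by (simp add: reduced_word_def reduced_expression_for_def expression_for_def Ball_def imp_conjL)

lemma red_length_le: "red u \<Longrightarrow> v \<in> lists S \<Longrightarrow> val v = val u \<Longrightarrow> length u \<le> length v"
  by (simp add: red_iff)

lemma red_lists: "red u \<Longrightarrow> u \<in> lists S"
  by (simp add: red_iff)

lemma reduced_expression_iff: "reduced_expression_for W S u w \<longleftrightarrow> red u \<and> val u = w"
  by (cases "val u = w") (auto simp: reduced_word_def reduced_expression_for_def expression_for_def)

lemma lists_delete: "u \<in> lists S \<Longrightarrow> take i u @ drop j u \<in> lists S"
  using set_take_subset[of i u] set_drop_subset[of j u] unfolding lists_eq_set by auto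

lemma ex_red:
  assumes "u \<in> lists S"
  obtains v where "red v" "val v = val u" "length v \<le> length u"
proof -
  define P where "P v \<longleftrightarrow> v \<in> lists S \<and> val v = val u" for v
  have "P u" using assms by (simp add: P_def)
  then obtain v where v: "P v" "\<forall>v'. P v' \<longrightarrow> length v \<le> length v'"
    using ex_has_least_nat[of P u length] by blast
  show ?thesis
  proof (rule that)
    show "red v" using v unfolding red_iff P_def by simp
    show "val v = val u" using v(1) by (simp add: P_def)
    show "length v \<le> length u" using v(2) \<open>P u\<close> by simp
  qed
qed

lemma red_factor:
  assumes "red (x @ u @ y)"
  shows "red u"
  unfolding red_iff
proof (intro conjI ballI impI)
  have xuy: "x \<in> lists S" "u \<in> lists S" "y \<in> lists S" using red_lists[OF assms] by auto
  show "u \<in> lists S" by fact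
  fix v assume v: "v \<in> lists S" "val v = val u"
  then have "val (x @ v @ y) = val (x @ u @ y)" using xuy by (simp add: val_append)
  then have "length (x @ u @ y) \<le> length (x @ v @ y)"
    using assms v xuy by (intro red_length_le) simp_all
  then show "length u \<le> length v" by simp
qed

text \<open>If two reflections agreed, deleting either of the two letters would give the same
  element, so deleting both would give back the element of \<open>u\<close>.\<close>

lemma red_distinct_refl:
  assumes "red u"
  shows "distinct (refls u)"
proof (rule ccontr)
  have u: "u \<in> lists S" using assms by (rule red_lists)
  assume "\<not> distinct (refls u)"
  then obtain i j where ij: "i < j" "j < length u" and eq: "refls u ! i = refls u ! j"
    unfolding distinct_conv_nth length_refls by (metis linorder_neqE_nat)
  define A s B t C where "A = take i u" and "s = u ! i" and "B = take (j - Suc i) (drop (Suc i) u)"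
    and "t = u ! j" and "C = drop (Suc j) u"
  have drop_i: "drop (Suc i) u = B @ t # C"
  proof -
    have "drop (Suc i) u = B @ drop (j - Suc i) (drop (Suc i) u)"
      unfolding B_def by (rule append_take_drop_id[symmetric])
    also have "drop (j - Suc i) (drop (Suc i) u) = t # C"
      using ij by (simp add: t_def C_def Cons_nth_drop_Suc)
    finally show ?thesis .
  qed
  have dec: "u = A @ s # B @ t # C"
    using ij id_take_nth_drop[of i u] drop_i by (simp add: A_def s_def)
  have letters: "A \<in> lists S" "s \<in> S" "B \<in> lists S" "t \<in> S" "C \<in> lists S"
    using u unfolding dec by auto
  have "length A = i" using ij by (simp add: A_def)
  have "length B = j - Suc i" using ij by (simp add: B_def)
  have "take j u = A @ s # B"
    using \<open>length A = i\<close> \<open>length B = j - Suc i\<close> ij unfolding dec by (simp add: take_Cons')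
  then have "val ((A @ s # B) @ C) = val (A @ B @ t # C)"
    using refls_delete[OF u, of i] refls_delete[OF u, of j] ij eq drop_i by (simp add: A_def C_def)
  then have "val A \<otimes> (s \<otimes> val B) \<otimes> val C = val A \<otimes> (val B \<otimes> t) \<otimes> val C"
    using letters by (simp add: val_append gen_closed m_assoc)
  then have "s \<otimes> val B = val B \<otimes> t"
    using letters by (simp add: gen_closed)
  then have "s \<otimes> val B \<otimes> t = val B \<otimes> t \<otimes> t" by simp
  also have "\<dots> = val B" using letters by (simp add: gen_closed m_assoc gen_square)
  finally have "val A \<otimes> (s \<otimes> val B \<otimes> t) \<otimes> val C = val (A @ B @ C)"
    using letters by (simp add: val_append m_assoc)
  moreover have "val A \<otimes> (s \<otimes> val B \<otimes> t) \<otimes> val C = val (A @ s # B @ t # C)"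
    using letters by (simp add: val_append gen_closed m_assoc)
  ultimately have "val (A @ s # B @ t # C) = val (A @ B @ C)" by simp
  then have "length u \<le> length (A @ B @ C)"
    using assms letters unfolding dec by (intro red_length_le) simp_all
  then show False unfolding dec by simp
qed

text \<open>A reduced word for the same element also has distinct reflections, and by parity they
  form the same set, so the lengths agree.\<close>

lemma distinct_refl_red:
  assumes "u \<in> lists S" "distinct (refls u)"
  shows "red u"
proof -
  obtain v where v: "red v" "val v = val u" "length v \<le> length u" using ex_red[OF assms(1)] .
  have "set (refls v) = set (refls u)"
  proof (rule distinct_even_count_eq)
    fix r assume "r \<in> set (refls v) \<union> set (refls u)"
    then have "r \<in> carrier W" using refls_closed assms(1) red_lists[OF v(1)] by blast
    then show "even (count_list (refls v) r) = even (count_list (refls u) r)"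
      using refl_parity[OF v(2) red_lists[OF v(1)] assms(1)] by blast
  qed (use red_distinct_refl[OF v(1)] assms(2) in auto)
  then have "length u = length v"
    using distinct_card[OF assms(2)] distinct_card[OF red_distinct_refl[OF v(1)]] by simp
  with v show ?thesis using assms(1) by (simp add: red_iff)
qed

text \<open>Conjugation by \<open>s\<close> is injective and fixes \<open>s\<close>, so if
  \<open>s\<close> is not a reflection of \<open>u\<close>, those of \<open>s # u\<close> are
  distinct.\<close>

lemma exchange:
  assumes "red u" "s \<in> S" "\<not> red (s # u)"
  shows "s \<in> set (refls u)"
proof (rule ccontr)
  assume s: "s \<notin> set (refls u)"
  have u: "u \<in> lists S" using assms red_lists by blast
  have "s \<notin> (\<lambda>r. s \<otimes> r \<otimes> inv s) ` set (refls u)"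
  proof
    assume "s \<in> (\<lambda>r. s \<otimes> r \<otimes> inv s) ` set (refls u)"
    then obtain r where r: "r \<in> set (refls u)" "s = s \<otimes> r \<otimes> inv s" by blast
    then have "r \<in> carrier W" using refls_closed[OF u] by blast
    then have "s \<otimes> s = s \<otimes> r" using r(2) gen_closed[OF assms(2)]
      by (metis inv_closed inv_solve_right m_closed)
    then have "r = s" using \<open>r \<in> carrier W\<close> gen_closed[OF assms(2)] by simp
    with r s show False by simp
  qed
  moreover have "inj_on (\<lambda>r. s \<otimes> r \<otimes> inv s) (set (refls u))"
  proof (rule inj_onI)
    fix x y assume "x \<in> set (refls u)" "y \<in> set (refls u)" and eq: "s \<otimes> x \<otimes> inv s = s \<otimes> y \<otimes> inv s"
    then have "x \<in> carrier W" "y \<in> carrier W" using refls_closed[OF u] by blast+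
    with eq show "x = y" using gen_closed[OF assms(2)] by simp
  qed
  ultimately have "distinct (refls (s # u))"
    using red_distinct_refl[OF assms(1)] by (simp add: distinct_map)
  then have "red (s # u)" using distinct_refl_red u assms(2) by simp
  with assms(3) show False by contradiction
qed


section \<open>Local characterisation of fully commutative words\<close>

lemma red_transfer:
  assumes "red u" "v \<in> lists S" "val v = val u" "length v = length u"
  shows "red v"
  using assms unfolding red_iff by simp

lemma red_length_eq: "red u \<Longrightarrow> red v \<Longrightarrow> val u = val v \<Longrightarrow> length u = length v"
  by (simp add: red_length_le red_lists le_antisym)

lemma ceq_val:
  assumes "u \<approx> v" "u \<in> lists S"
  shows "val v = val u"
proof -
  from assms(1) have "v \<in> lists S \<and> val v = val u"
  proof (induction rule: ceq_induct)
    case base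
    show ?case using assms(2) by simp
  next
    case (swap x y s t)
    then have xy: "x \<in> lists S" "y \<in> lists S" by auto
    have "m s t = enat 2" using swap(3) by (simp add: numeral_eq_enat)
    from val_alternating_swap[OF swap(1,2) this] have "val [s, t] = val [t, s]"
      by (simp add: numeral_2_eq_2)
    moreover have "val (x @ [s, t] @ y) = val x \<otimes> (val [s, t] \<otimes> val y)"
      "val (x @ [t, s] @ y) = val x \<otimes> (val [t, s] \<otimes> val y)"
      using swap(1,2) xy by (simp_all add: val_append m_assoc gen_closed)
    ultimately show ?case using swap xy by simp
  qed
  then show ?thesis by blast
qed

text \<open>
  Take a reduced expression with an alternating prefix of maximal length \<open>p\<close>. Exchanging with the
  descent missing at its front either lengthens the prefix or deletes a letter inside it; the
  latter shows that the order of \<open>st\<close> is at most \<open>p\<close>.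
\<close>

lemma exists_dihedral_prefix:
  assumes "red (s # x)" "red (t # y)" "val (s # x) = val (t # y)" "s \<noteq> t"
  obtains k z where "m s t = enat k" "red (alternating s t k @ z)"
    "val (alternating s t k @ z) = val (s # x)"
proof -
  define w where "w = val (s # x)"
  \<comment> \<open>The prefix may begin with either letter, since lengthening it puts the other one
    in front.\<close>
  define Q where "Q p \<longleftrightarrow> (\<exists>a b z. {a, b} = {s, t} \<and> red (alternating a b p @ z) \<and>
    val (alternating a b p @ z) = w)" for p
  have st: "s \<in> S" "t \<in> S" using red_lists[OF assms(1)] red_lists[OF assms(2)] by auto
  have "alternating s t 1 @ x = s # x" by simp
  then have Q1: "Q 1" unfolding Q_def w_def
    using assms(1) by (intro exI[of _ s] exI[of _ t] exI[of _ x]) (simp del: alternating.simps)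
  have "\<forall>p. Q p \<longrightarrow> p < Suc (length (s # x))"
  proof (intro allI impI)
    fix p assume "Q p"
    then obtain a b z where z: "red (alternating a b p @ z)" "val (alternating a b p @ z) = w"
      unfolding Q_def by blast
    have "length (alternating a b p @ z) = length (s # x)"
      using red_length_eq[OF z(1) assms(1)] z(2) unfolding w_def .
    then show "p < Suc (length (s # x))" by simp
  qed
  from ex_has_greatest_nat[of Q 1 "\<lambda>p. p", OF Q1 this]
  obtain p where p: "Q p" "\<And>q. Q q \<Longrightarrow> q \<le> p" by auto
  from p(1) obtain a b z where ab: "{a, b} = {s, t}" and
    Z: "red (alternating a b p @ z)" "val (alternating a b p @ z) = w"
    unfolding Q_def by blast
  have "a \<noteq> b" "a \<in> S" "b \<in> S" using ab assms(4) st by (auto simp: doubleton_eq_iff)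
  define A where "A = alternating a b p"
  have A: "A \<in> lists S" "length A = p"
    using \<open>a \<in> S\<close> \<open>b \<in> S\<close> by (simp_all add: A_def alternating_lists)
  define Z where "Z = A @ z"
  have Z: "red Z" "val Z = w" using Z by (simp_all add: Z_def A_def)
  have ZS: "Z \<in> lists S" using Z(1) by (rule red_lists)
  then have zS: "z \<in> lists S" by (simp add: Z_def)
  have "\<exists>x'. red (b # x') \<and> val (b # x') = w"
  proof (cases "b = s")
    case True
    then show ?thesis using assms(1) by (intro exI[of _ x]) (simp add: w_def)
  next
    case False
    then have "b = t" using ab by (auto simp: doubleton_eq_iff)
    then show ?thesis using assms(2,3) by (intro exI[of _ y]) (simp add: w_def)
  qed
  then obtain x' where x': "red (b # x')" "val (b # x') = w" by blast
  have x'S: "x' \<in> lists S" using red_lists[OF x'(1)] by simp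
  have "val Z = b \<otimes> val x'" using Z x' by simp
  then have bZ: "val x' = val (b # Z)" using x'S \<open>b \<in> S\<close> by simp
  have "length x' < length (b # Z)"
    using red_length_eq[OF Z(1) x'(1)] Z x' by simp
  then have "\<not> red (b # Z)" using red_length_le[OF _ x'S bZ] by linarith
  then have "b \<in> set (refls Z)" using exchange[OF Z(1) \<open>b \<in> S\<close>] by blast
  then obtain i where i: "i < length Z" "refls Z ! i = b" by (metis in_set_conv_nth length_refls)
  show ?thesis
  proof (cases "i < p")
    case True
    have "refls Z ! i = refls A ! i"
      using refls_append[OF A(1) zS] True A(2) by (simp add: Z_def nth_append)
    also have "\<dots> = val (alternating a b (2 * i + 1))"
      using refls_alternating[OF \<open>a \<in> S\<close> \<open>b \<in> S\<close>, of p] True by (simp add: A_def del: alternating.simps)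
    finally have b: "val (alternating a b (2 * i + 1)) = b" using i(2) by simp
    have len: "2 * (i + 1) = Suc (2 * i + 1)" by simp
    have one: "val (alternating b a (2 * (i + 1))) = \<one>"
      unfolding len alternating.simps(2)[of b a] val_Cons b using \<open>b \<in> S\<close> by (rule gen_square)
    have "m b a \<le> enat (i + 1)"
      using order_ge[OF \<open>b \<in> S\<close> \<open>a \<in> S\<close> \<open>a \<noteq> b\<close>[symmetric] _ one] by simp
    then obtain k where k: "m b a = enat k" "k \<le> i + 1" by (cases "m b a") auto
    define r where "r = (if even k then alternating a b (p - k) else alternating b a (p - k))"
    have "k \<le> p" using k True by simp
    then have "A = alternating a b k @ r"
      using alternating_append[of a b k "p - k"] by (simp add: A_def r_def)
    then have Zk: "Z = alternating a b k @ (r @ z)" by (simp add: Z_def)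
    have mab: "m a b = enat k" using k m_sym \<open>a \<in> S\<close> \<open>b \<in> S\<close> by simp
    consider "a = s" "b = t" | "a = t" "b = s" using ab by (auto simp: doubleton_eq_iff)
    then show ?thesis
    proof cases
      case 1
      then show ?thesis using that[of k "r @ z"] mab Z Zk w_def by simp
    next
      case 2
      \<comment> \<open>The prefix begins with \<open>t\<close>; as it contains a full braid,
        swapping that braid makes it begin with \<open>s\<close>.\<close>
      define Y where "Y = alternating s t k @ (r @ z)"
      have rz: "r @ z \<in> lists S" using ZS unfolding Zk by simp
      have "val (alternating s t k) = val (alternating t s k)"
        using val_alternating_swap[OF st, of k] k 2 by simp
      then have "val Y = val Z"
        unfolding Y_def Zk 2 using rz st alternating_lists by (simp add: val_append)
      moreover have "length Y = length Z" "Y \<in> lists S"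
        unfolding Y_def Zk using rz st alternating_lists by simp_all
      ultimately have "red Y" using red_transfer[OF Z(1)] by blast
      then show ?thesis using that[of k "r @ z"] \<open>val Y = val Z\<close> k Z(2) 2
        unfolding Y_def w_def by simp
    qed
  next
    case False
    define z' where "z' = take (i - p) z @ drop (Suc i) Z"
    have Z': "b # take i Z @ drop (Suc i) Z = alternating b a (Suc p) @ z'"
      using False A(2) by (simp add: z'_def Z_def A_def)
    have sub: "take i Z @ drop (Suc i) Z \<in> lists S"
      using ZS by (rule lists_delete)
    have "val (b # take i Z @ drop (Suc i) Z) = b \<otimes> (b \<otimes> w)"
      using refls_delete[OF ZS i(1)] i(2) Z(2) by simp
    then have v: "val (b # take i Z @ drop (Suc i) Z) = w"
      using \<open>b \<in> S\<close> val_closed[OF ZS] unfolding Z(2) by simp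
    have "red (b # take i Z @ drop (Suc i) Z)"
    proof (rule red_transfer[OF Z(1)])
      show "length (b # take i Z @ drop (Suc i) Z) = length Z" using i(1) by simp
    qed (use sub v Z(2) \<open>b \<in> S\<close> in simp_all)
    then have "Q (Suc p)" unfolding Q_def
      using ab v unfolding Z' by (intro exI[of _ b] exI[of _ a] exI[of _ z']) (simp add: insert_commute)
    with p(2) have False by fastforce
    then show ?thesis ..
  qed
qed

section \<open>Words whose commutation class avoids squares and braids\<close>

definition forbidden :: "'g list \<Rightarrow> bool" where
  "forbidden z \<longleftrightarrow> (\<exists>s\<in>S. sublist [s, s] z) \<or>
    (\<exists>s\<in>S. \<exists>t\<in>S. \<exists>k. m s t = enat k \<and> k \<ge> 3 \<and> sublist (alternating s t k) z)"

definition local_FC :: "'g list \<Rightarrow> bool" where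
  "local_FC u \<longleftrightarrow> u \<in> lists S \<and> (\<forall>v. u \<approx> v \<longrightarrow> \<not> forbidden v)"

lemma forbidden_append: "forbidden u \<Longrightarrow> forbidden (x @ u @ y)"
proof -
  have *: "sublist p u \<Longrightarrow> sublist p (x @ u @ y)" for p
    using sublist_order.order_trans[OF _ sublist_appendI[of u x y]] .
  assume "forbidden u"
  then show ?thesis unfolding forbidden_def by (auto dest: *)
qed

lemma local_FC_lists: "local_FC u \<Longrightarrow> u \<in> lists S"
  by (simp add: local_FC_def)

lemma local_FC_factor:
  assumes "local_FC (x @ u @ y)"
  shows "local_FC u"
  unfolding local_FC_def
proof (intro conjI allI impI)
  show "u \<in> lists S" using local_FC_lists[OF assms] by simp
  fix v assume "u \<approx> v"
  then have "x @ u @ y \<approx> x @ v @ y" by (rule ceq_append)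
  then have "\<not> forbidden (x @ v @ y)" using assms unfolding local_FC_def by simp
  then show "\<not> forbidden v" using forbidden_append[of v x y] by blast
qed

lemma local_FC_ceq:
  assumes "local_FC u" "u \<approx> v"
  shows "local_FC v"
  unfolding local_FC_def
proof (intro conjI allI impI)
  show "v \<in> lists S" using ceq_lists[OF assms(2)] local_FC_lists[OF assms(1)] by simp
  fix v' assume "v \<approx> v'"
  with assms(2) have "u \<approx> v'" by (rule ceq_trans)
  then show "\<not> forbidden v'" using assms(1) unfolding local_FC_def by simp
qed

lemma local_FC_not_square: "local_FC u \<Longrightarrow> s \<in> S \<Longrightarrow> \<not> u \<approx> x @ s # s # y"
proof
  assume "local_FC u" "s \<in> S" "u \<approx> x @ s # s # y"
  moreover have "sublist [s, s] (x @ [s, s] @ y)" by (rule sublist_appendI)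
  ultimately show False unfolding local_FC_def forbidden_def by simp
qed

lemma local_FC_not_braid:
  assumes "local_FC u" "s \<in> S" "t \<in> S" "m s t = enat k" "k \<ge> 3"
  shows "\<not> u \<approx> x @ alternating s t k @ y"
proof
  assume "u \<approx> x @ alternating s t k @ y"
  moreover have "sublist (alternating s t k) (x @ alternating s t k @ y)"
    by (rule sublist_appendI)
  then have "forbidden (x @ alternating s t k @ y)"
    unfolding forbidden_def using assms(2-5) by blast
  ultimately show False using assms(1) unfolding local_FC_def by simp
qed

text \<open>Matsumoto's argument, in which every braid of length at least 3 is ruled out.
  Reducedness and uniqueness go together: if \<open>s # u'\<close> is not reduced, exchange gives a
  reduced expression \<open>s # z\<close> of \<open>u'\<close>, and uniqueness for \<open>u'\<close>
  turns it into a square in the class of \<open>u\<close>.\<close>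

lemma local_FC_reduced:
  assumes "local_FC u"
  shows "red u \<and> (\<forall>v. red v \<and> val v = val u \<longrightarrow> u \<approx> v)"
  using assms
proof (induction "length u" arbitrary: u)
  case 0
  then have u: "u = []" by simp
  have "u \<approx> v" if "red v" "val v = val u" for v
    using red_length_le[OF that(1), of "[]"] that(2) u by simp
  moreover have "red u" by (simp add: red_iff u)
  ultimately show ?case by blast
next
  case (Suc n)
  then obtain s u' where u: "u = s # u'" and len: "length u' = n" by (metis length_Suc_conv)
  have uS: "u \<in> lists S" using Suc.prems by (rule local_FC_lists)
  then have s: "s \<in> S" "u' \<in> lists S" using u by auto
  have "local_FC u'" using local_FC_factor[of "[s]" u' "[]"] Suc.prems u by simp
  then have IH': "red u'" "\<And>v. red v \<Longrightarrow> val v = val u' \<Longrightarrow> u' \<approx> v"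
    using Suc.hyps(1)[OF len[symmetric]] by blast+
  have red: "red u"
  proof (rule ccontr)
    assume "\<not> red u"
    then have "s \<in> set (refls u')" using exchange[OF IH'(1) s(1)] u by blast
    then obtain i where i: "i < length u'" "refls u' ! i = s" by (metis in_set_conv_nth length_refls)
    define z where "z = take i u' @ drop (Suc i) u'"
    have zS: "z \<in> lists S" unfolding z_def using s(2) by (rule lists_delete)
    have "val z = s \<otimes> val u'" using refls_delete[OF s(2) i(1)] i(2) by (simp add: z_def)
    then have "val (s # z) = val u'" using s by simp
    moreover have "length (s # z) = length u'" using i(1) by (simp add: z_def)
    ultimately have "red (s # z)" using red_transfer[OF IH'(1)] s zS by simp
    then have "u' \<approx> s # z" using IH'(2) \<open>val (s # z) = val u'\<close> by blast
    then have "u \<approx> s # s # z" unfolding u by (rule ceq_Cons)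
    then show False using local_FC_not_square[OF Suc.prems s(1), of "[]"] by simp
  qed
  moreover have "u \<approx> v" if v: "red v" "val v = val u" for v
  proof -
    have "length v = Suc n" using red_length_eq[OF v(1) red v(2)] u len by simp
    then obtain t v' where tv: "v = t # v'" by (metis length_Suc_conv)
    have t: "t \<in> S" "v' \<in> lists S" using red_lists[OF v(1)] tv by auto
    have v': "red v'" using red_factor[of "[t]" v' "[]"] v(1) tv by simp
    show ?thesis
    proof (cases "s = t")
      case True
      then have "val v' = val u'" using v(2) s t unfolding u tv by (simp add: gen_closed)
      then have "u' \<approx> v'" using IH'(2) v' by blast
      then show ?thesis unfolding u tv True by (rule ceq_Cons)
    next
      case False
      \<comment> \<open>The prefix starts with \<open>s\<close>, the first letter of
        \<open>u\<close>; stripping it lets the induction hypothesis for \<open>u'\<close> carry the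
        braid into the class of \<open>u\<close>.\<close>
      obtain k z where k: "m s t = enat k" and z: "red (alternating s t k @ z)"
        "val (alternating s t k @ z) = val u"
        using exists_dihedral_prefix[of s u' t v'] red v False unfolding u tv by metis
      have "k \<ge> 2" using m_ge_1[OF s(1) t(1)] m_eq_1_iff[OF s(1) t(1)] k False
        by (auto simp: one_enat_def)
      then obtain l where l: "k = Suc (Suc l)" by (metis add_2_eq_Suc le_Suc_ex)
      define y where "y = alternating t s (Suc l) @ z"
      have sy: "alternating s t k @ z = s # y" by (simp add: l y_def)
      have "red y" using red_factor[of "[s]" y "[]"] z(1) unfolding sy by simp
      moreover have "val y = val u'"
        using z(2) s red_lists[OF \<open>red y\<close>] unfolding sy u by (simp add: gen_closed)
      ultimately have "u' \<approx> y" using IH'(2) by blast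
      then have u_eq: "u \<approx> alternating s t k @ z" unfolding sy u by (rule ceq_Cons)
      then have "k < 3" using local_FC_not_braid[OF Suc.prems s(1) t(1) k, of "[]" z] by fastforce
      then have "k = 2" using \<open>k \<ge> 2\<close> by simp
      then have st: "m s t = 2" "alternating s t k = [s, t]"
        using k by (simp_all add: numeral_eq_enat numeral_2_eq_2)
      \<comment> \<open>Now \<open>t\<close> can come first in \<open>u\<close> as well, and the
        rest is compared with \<open>v'\<close> by induction.\<close>
      have "u \<approx> t # s # z"
        using ceq_trans[OF u_eq] ceq_swap[OF s(1) t(1) st(1), of "[]" z] st(2) by simp
      then have "local_FC (t # s # z)" using local_FC_ceq Suc.prems by blast
      then have "local_FC (s # z)" using local_FC_factor[of "[t]" "s # z" "[]"] by simp
      moreover have szS: "s # z \<in> lists S" using local_FC_lists[OF calculation] .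
      have "length (s # z) = n" using ceq_length[OF \<open>u \<approx> t # s # z\<close>] u len by simp
      have "val (t # s # z) = val u" using ceq_val[OF \<open>u \<approx> t # s # z\<close> uS] .
      then have "t \<otimes> val v' = t \<otimes> val (s # z)" using v(2) unfolding tv by simp
      then have "val v' = val (s # z)"
        using gen_closed[OF t(1)] val_closed[OF t(2)] val_closed[OF szS] by (simp del: val_Cons)
      ultimately have "s # z \<approx> v'"
        using Suc.hyps(1)[of "s # z"] \<open>length (s # z) = n\<close> v' by blast
      then have "t # s # z \<approx> v" unfolding tv by (rule ceq_Cons)
      with \<open>u \<approx> t # s # z\<close> show ?thesis by (rule ceq_trans)
    qed
  qed
  ultimately show ?case by blast
qed

text \<open>A square is not reduced. Swapping a braid gives another reduced expression of the same
  element, whose projection to \<open>{s, t}\<close> differs, so it is not commutation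
  equivalent.\<close>

lemma FC_word_local_FC:
  assumes "FC_word W S m u"
  shows "local_FC u"
  unfolding local_FC_def
proof (intro conjI allI impI)
  have u: "red u" "\<And>v. red v \<Longrightarrow> val v = val u \<Longrightarrow> u \<approx> v"
    using assms unfolding FC_word_def FC_def reduced_expression_iff by blast+
  show uS: "u \<in> lists S" using u(1) by (rule red_lists)
  fix v assume v: "u \<approx> v"
  have vS: "v \<in> lists S" and val_v: "val v = val u" and len: "length v = length u"
    using ceq_lists[OF v] ceq_val[OF v uS] ceq_length[OF v] uS by auto
  have red_v: "red v" using red_transfer[OF u(1) vS val_v len] .
  show "\<not> forbidden v"
  proof
    assume "forbidden v"
    then consider s where "s \<in> S" "sublist [s, s] v"
      | s t k where "s \<in> S" "t \<in> S" "m s t = enat k" "k \<ge> 3" "sublist (alternating s t k) v"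
      unfolding forbidden_def by blast
    then show False
    proof cases
      case 1
      then have "red [s, s]" using red_v red_factor unfolding sublist_def by blast
      from red_length_le[OF this, of "[]"] show False
        using gen_square[OF 1(1)] gen_closed[OF 1(1)] by simp
    next
      case 2
      from 2(5) obtain x y where v_eq: "v = x @ alternating s t k @ y" unfolding sublist_def by blast
      define v' where "v' = x @ alternating t s k @ y"
      have xy: "x \<in> lists S" "y \<in> lists S" using vS v_eq by auto
      have "val v' = val v"
        using val_alternating_swap[OF 2(1-3)] xy 2 alternating_lists
        unfolding v_eq v'_def by (simp add: val_append)
      moreover have "v' \<in> lists S" "length v' = length v"
        using xy 2 alternating_lists unfolding v'_def v_eq by auto
      ultimately have "u \<approx> v'" using u(2) red_transfer[OF red_v] val_v by metis
      then have "v \<approx> v'" using v ceq_sym ceq_trans by blast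
      moreover have "m s t \<noteq> 2" using 2 by (auto simp: numeral_eq_enat)
      ultimately have eq: "filter (\<lambda>x. x = s \<or> x = t) v = filter (\<lambda>x. x = s \<or> x = t) v'"
        using ceq_filter 2 by blast
      have "filter (\<lambda>x. x = s \<or> x = t) (alternating s t k) = alternating s t k"
        "filter (\<lambda>x. x = s \<or> x = t) (alternating t s k) = alternating t s k"
        using set_alternating_subset[of s t k] set_alternating_subset[of t s k]
        by (auto intro!: filter_True)
      with eq have "alternating s t k = alternating t s k" unfolding v_eq v'_def by simp
      then have "s = t" using 2(4) by (cases k) auto
      then show False using m_self[OF 2(1)] 2(3,4) by (auto simp: one_enat_def)
    qed
  qed
qed

lemma FC_word_iff: "FC_word W S m u \<longleftrightarrow> local_FC u"
proof
  assume "local_FC u"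
  then have u: "red u" "\<And>v. red v \<Longrightarrow> val v = val u \<Longrightarrow> u \<approx> v"
    using local_FC_reduced by blast+
  have "v \<approx> v'" if "red v" "val v = val u" "red v'" "val v' = val u" for v v'
    using u(2)[OF that(1,2)] u(2)[OF that(3,4)] ceq_sym ceq_trans by blast
  then have "val u \<in> FC W S m"
    using val_closed[OF red_lists[OF u(1)]] unfolding FC_def reduced_expression_iff by blast
  then show "FC_word W S m u" using u(1) unfolding FC_word_def reduced_expression_iff by blast
qed (rule FC_word_local_FC)

end

section \<open>Periodic words\<close>

text \<open>The factor of \<open>u u u ...\<close> of length \<open>l\<close> at position
  \<open>i\<close>. Unlike powers, factors can be shortened by one letter at either end.\<close>

definition window :: "'a list \<Rightarrow> nat \<Rightarrow> nat \<Rightarrow> 'a list" where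
  "window u i l = map (\<lambda>j. u ! ((i + j) mod length u)) [0..<l]"

lemma length_window [simp]: "length (window u i l) = l"
  by (simp add: window_def)

lemma window_append: "window u i (k + l) = window u i k @ window u (i + k) l"
  by (rule nth_equalityI) (auto simp: window_def nth_append add.assoc)

lemma window_period: "window u (i + length u) l = window u i l"
proof -
  have "(i + length u + j) mod length u = (i + j) mod length u" for j
    using mod_add_self2[of "i + j" "length u"] by (simp add: ac_simps)
  then show ?thesis by (simp add: window_def)
qed

lemma window_Suc: "window u i (Suc l) = u ! (i mod length u) # window u (Suc i) l"
  using window_append[of u i 1 l] by (simp add: window_def)

lemma window_snoc: "window u i (Suc l) = window u i l @ [u ! ((i + l) mod length u)]"
  by (simp add: window_def)

lemma window_rotate: "window u i (length u) = rotate i u"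
  by (rule nth_equalityI) (simp_all add: window_def nth_rotate)

lemma mset_rotate: "mset (rotate i xs) = mset xs"
proof -
  let ?k = "i mod length xs"
  have "mset (rotate i xs) = mset (take ?k xs @ drop ?k xs)"
    by (simp only: rotate_drop_take mset_append add.commute)
  then show ?thesis by simp
qed

lemma window_power: "window u 0 (k * length u) = concat (replicate k u)"
proof (induction k)
  case (Suc k)
  have "window u 0 (Suc k * length u) = window u 0 (length u) @ window u (0 + length u) (k * length u)"
    unfolding mult_Suc by (rule window_append)
  with Suc show ?case by (simp only: window_period window_rotate) simp
qed (simp add: window_def)

text \<open>The letter at offset \<open>j\<close> returns \<open>length u\<close> places later, and
  \<open>a # q\<close> is a full rotation of \<open>u\<close>. The \<open>Suc\<close> leaves room
  for the second \<open>a\<close>.\<close>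

lemma window_recurrence:
  assumes "u \<noteq> []" "j + Suc (length u) \<le> l" and a: "a = u ! ((i + j) mod length u)"
  obtains p q r where "window u i l = p @ a # q @ a # r" "set (a # q) = set u"
proof -
  obtain n' where n': "length u = Suc n'" using assms(1) by (cases u) auto
  define r where "r = l - (j + Suc (length u))"
  have l: "l = j + (length u + Suc r)" using assms(2) by (simp add: r_def)
  define q where "q = window u (Suc (i + j)) n'"
  have w: "window u (i + j) (length u) = a # q"
    using window_Suc[of u "i + j" n'] by (simp add: a q_def n')
  have "window u i l = window u i j @ window u (i + j) (length u) @ window u (i + j + length u) (Suc r)"
    unfolding l by (simp only: window_append)
  also have "window u (i + j + length u) (Suc r) = a # window u (Suc (i + j)) r"
    unfolding window_period by (simp add: window_Suc a)
  finally have "window u i l = window u i j @ a # q @ a # window u (Suc (i + j)) r"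
    unfolding w by simp
  moreover have "set (a # q) = set u" using window_rotate[of u "i + j"] unfolding w[symmetric] by simp
  ultimately show ?thesis by (rule that)
qed

lemma subseq_Cons_skip: "subseq (d # w) (p @ q) \<Longrightarrow> d \<notin> set p \<Longrightarrow> subseq (d # w) q"
  by (induction p) auto

lemma subseq_ConsI: "subseq w q \<Longrightarrow> subseq (d # w) (p @ d # q)"
  by (intro list_emb_append2) simp

lemma subseq_set: "subseq xs ys \<Longrightarrow> set xs \<subseteq> set ys"
  by (auto dest: list_emb_set)

lemma alternating_adjacent:
  "alternating s t k = p @ [a, b] @ q \<Longrightarrow> s \<noteq> t \<Longrightarrow> a \<noteq> b"
proof (induction p arbitrary: s t k)
  case Nil
  have "length (alternating s t k) = length ([] @ [a, b] @ q)" by (simp only: Nil(1))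
  then have "k = Suc (Suc (length q))" by simp
  with Nil show ?case by simp
next
  case (Cons x p)
  then obtain l where "k = Suc l" by (cases k) auto
  with Cons.prems have "alternating t s l = p @ [a, b] @ q" "t \<noteq> s" by auto
  then show ?case by (rule Cons.IH)
qed

context coxeter_system
begin

lemma ceq_append_cong:
  assumes "u \<approx> v" "u' \<approx> v'"
  shows "u @ u' \<approx> v @ v'"
proof -
  have "u @ u' \<approx> v @ u'" using ceq_append[OF assms(1), of "[]" u'] by simp
  also have "v @ u' \<approx> v @ v'" using ceq_append[OF assms(2), of v "[]"] by simp
  finally show ?thesis .
qed

lemma ceq_power: "u \<approx> v \<Longrightarrow> concat (replicate k u) \<approx> concat (replicate k v)"
  by (induction k) (simp_all add: ceq_append_cong)

lemma ceq_cancel_snoc: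
  assumes "u @ [p] \<approx> v @ [p]" "u @ [p] \<in> lists S"
  shows "u \<approx> v"
proof -
  have "p # rev u \<approx> p # rev v" using ceq_rev[OF assms(1)] by simp
  moreover have "p # rev u \<in> lists S" using assms(2) by simp
  ultimately have "rev u \<approx> rev v" by (rule ceq_cancel_Cons)
  from ceq_rev[OF this] show ?thesis by simp
qed

text \<open>If the first \<open>p\<close> were in \<open>x\<close> or \<open>y\<close>, it could be
  cancelled there with \<open>c\<close> left intact, against \<open>min\<close>. So it lies in
  \<open>c\<close>; all letters before it commute with it, and no letter of \<open>c\<close>
  does.\<close>

lemma peel_first:
  assumes "p # u \<approx> x @ c @ y" "p # u \<in> lists S"
    and nc: "\<And>q r. q \<in> set c \<Longrightarrow> r \<in> set c \<Longrightarrow> m q r \<noteq> 2"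
    and min: "\<And>x' y'. \<not> u \<approx> x' @ c @ y'"
  shows "hd c = p" "p \<in> set c" "\<forall>q\<in>set x. m p q = 2"
proof -
  have "p \<notin> set x"
  proof
    assume "p \<in> set x"
    then obtain x1 x2 where x: "x = x1 @ p # x2" "p \<notin> set x1" by (meson split_list_first)
    then have "p # u \<approx> x1 @ p # (x2 @ c @ y)" using assms(1) by simp
    from ceq_cancel_first(1)[OF this assms(2) x(2)] show False using min[of "x1 @ x2" y] by simp
  qed
  show pc: "p \<in> set c"
  proof (rule ccontr)
    assume "p \<notin> set c"
    then have "p \<in> set y" using ceq_set[OF assms(1)] \<open>p \<notin> set x\<close> by auto
    then obtain y1 y2 where y: "y = y1 @ p # y2" "p \<notin> set y1" by (meson split_list_first)
    then have "p # u \<approx> (x @ c @ y1) @ p # y2" using assms(1) by simp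
    from ceq_cancel_first(1)[OF this assms(2)] show False
      using min[of x "y1 @ y2"] y(2) \<open>p \<notin> set x\<close> \<open>p \<notin> set c\<close> by simp
  qed
  then obtain c1 c2 where c: "c = c1 @ p # c2" "p \<notin> set c1" by (meson split_list_first)
  then have "p # u \<approx> (x @ c1) @ p # (c2 @ y)" using assms(1) by simp
  from ceq_cancel_first(2)[OF this assms(2)] have *: "\<forall>q\<in>set (x @ c1). m p q = 2"
    using c(2) \<open>p \<notin> set x\<close> by simp
  then show "\<forall>q\<in>set x. m p q = 2" by simp
  have "c1 = []"
  proof (rule ccontr)
    assume "c1 \<noteq> []"
    then have "hd c1 \<in> set c1" by simp
    then show False using * nc[OF pc, of "hd c1"] c(1) by simp
  qed
  then show "hd c = p" using c(1) by simp
qed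

lemma peel_last:
  assumes "u @ [p] \<approx> x @ c @ y" "u @ [p] \<in> lists S"
    and nc: "\<And>q r. q \<in> set c \<Longrightarrow> r \<in> set c \<Longrightarrow> m q r \<noteq> 2"
    and min: "\<And>x' y'. \<not> u \<approx> x' @ c @ y'"
  shows "last c = p" "p \<in> set c" "\<forall>q\<in>set y. m p q = 2"
proof -
  have 1: "p # rev u \<approx> rev y @ rev c @ rev x" using ceq_rev[OF assms(1)] by simp
  have 2: "p # rev u \<in> lists S" using assms(2) by simp
  have 3: "\<not> rev u \<approx> x' @ rev c @ y'" for x' y'
  proof
    assume "rev u \<approx> x' @ rev c @ y'"
    from ceq_rev[OF this] show False using min[of "rev y'" "rev x'"] by simp
  qed
  note peel_first[OF 1 2 _ 3]
  from this nc show "last c = p" "p \<in> set c" "\<forall>q\<in>set y. m p q = 2"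
    by (simp_all add: hd_rev)
qed

lemma edge_out:
  assumes "irreducible_system S m" "X \<subseteq> S" "s \<in> X" "t \<in> S" "t \<notin> X"
  obtains a d where "a \<in> X" "d \<in> S" "d \<notin> X" "m a d \<ge> 3"
proof -
  have "\<exists>a d. a \<in> X \<and> d \<in> S \<and> d \<notin> X \<and> m a d \<ge> 3"
  proof (rule ccontr)
    assume *: "\<not> ?thesis"
    have "(s, t) \<in> (coxeter_graph S m)\<^sup>*"
      using assms unfolding irreducible_system_def by blast
    then have "t \<in> X"
    proof (induction rule: rtrancl_induct)
      case (step y z)
      then show ?case using * unfolding coxeter_graph_def by auto
    qed (rule assms(3))
    with assms(5) show False by contradiction
  qed
  then show ?thesis using that by blast
qed

text \<open>A square is treated as the case \<open>a = b\<close>, so that one argument about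
  non-commuting letters covers both kinds of forbidden subword.\<close>

lemma forbidden_chain:
  assumes "forbidden z"
  obtains x c y a b where "z = x @ c @ y" "a \<in> S" "b \<in> S" "set c = {a, b}" "hd c = a" "m a b \<noteq> 2" "forbidden c"
    "a = b \<or> (\<exists>k\<ge>3. m a b = enat k \<and> c = alternating a b k)"
proof -
  from assms consider s where "s \<in> S" "sublist [s, s] z"
    | s t k where "s \<in> S" "t \<in> S" "m s t = enat k" "k \<ge> 3" "sublist (alternating s t k) z"
    unfolding forbidden_def by blast
  then show ?thesis
  proof cases
    case 1
    then obtain x y where "z = x @ [s, s] @ y" unfolding sublist_def by blast
    moreover have "forbidden [s, s]" unfolding forbidden_def using 1 by blast
    ultimately show ?thesis using that[of x "[s, s]" y s s] 1 m_self[of s] by simp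
  next
    case 2
    then obtain x y where z: "z = x @ alternating s t k @ y" unfolding sublist_def by blast
    have "forbidden (alternating s t k)" unfolding forbidden_def using 2(1-4) by blast
    moreover have "k = Suc (Suc (k - 2))" using 2(4) by simp
    then obtain l where l: "k = Suc (Suc l)" by blast
    have "set (alternating s t k) = {s, t}" "hd (alternating s t k) = s"
      using set_alternating_subset[of s t k] l by auto
    moreover have "m s t \<noteq> 2" using 2 by (auto simp: numeral_eq_enat)
    ultimately show ?thesis using that[OF z 2(1,2)] 2(3,4) by blast
  qed
qed


section \<open>Bands\<close>

lemma neighbour_of_endpoint:
  assumes "odd_endpoint S m s" "m s t \<ge> 3" "t \<in> S" "d \<in> S" "d \<noteq> s" "d \<noteq> t"
  shows "m s d = 2"
proof (rule ccontr)
  assume "m s d \<noteq> 2"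
  have s: "s \<in> S" "card (coxeter_graph S m `` {s}) = 1"
    using assms(1) unfolding odd_endpoint_def endpoint_def by auto
  then have "m s d \<ge> 3" using m_ge_3_iff[of s d] assms(4,5) \<open>m s d \<noteq> 2\<close> by simp
  then have "{t, d} \<subseteq> coxeter_graph S m `` {s}"
    using assms s(1) unfolding coxeter_graph_def by auto
  then have "card {t, d} \<le> 1"
    using s(2) by (metis card_mono card.infinite one_neq_zero)
  then show False using assms(6) by simp
qed

lemma odd_endpoint_weight:
  assumes "odd_endpoint S m s" "m s t = enat k" "k \<ge> 3" "t \<in> S"
  shows "odd k"
proof -
  have mst: "m s t \<ge> 3" using assms(2,3) by (simp add: numeral_eq_enat)
  obtain t' k' where t': "(s, t') \<in> coxeter_graph S m" "m s t' = enat k'" "odd k'"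
    using assms(1) unfolding odd_endpoint_def by blast
  then have "t' \<in> S" "s \<in> S" "m s t' \<ge> 3" unfolding coxeter_graph_def by auto
  then have "t' \<noteq> s" "m s t' \<noteq> 2" using m_ge_3_iff[of s t'] by auto
  then have "t' = t" using neighbour_of_endpoint[OF assms(1) mst assms(4) \<open>t' \<in> S\<close>] by blast
  then show ?thesis using t' assms(2) by simp
qed

text \<open>As \<open>k\<close> is odd, the alternating word of length \<open>k - 1\<close> runs
  from \<open>s\<close> to \<open>t\<close>. If \<open>s\<close> is the endpoint, the first
  \<open>s\<close> of the second copy moves left and closes the braid; if \<open>t\<close> is, the
  last \<open>t\<close> of the first copy moves right and opens it.\<close>

lemma band_not_local_FC:
  assumes s: "s \<in> S" "t \<in> S" "m s t = enat k" "k \<ge> 3"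
    and one: "odd_endpoint S m s \<or> odd_endpoint S m t"
    and v: "v = x @ alternating s t (k - 1) @ y" "v \<in> lists S"
    and nosx: "s \<notin> set (x @ y)" "t \<notin> set (x @ y)"
  shows "\<not> local_FC (v @ v)"
proof
  assume vv: "local_FC (v @ v)"
  have mst: "m s t \<ge> 3" "m t s \<ge> 3" "m t s = enat k"
    using s m_sym[of s t] by (simp_all add: numeral_eq_enat)
  define c where "c = alternating s t (k - 1)"
  have xy: "set (y @ x) \<subseteq> S" using v by auto
  from one show False
  proof
    assume e: "odd_endpoint S m s"
    have "\<forall>q\<in>set (y @ x). q \<in> S \<and> m s q = 2"
    proof
      fix q assume q: "q \<in> set (y @ x)"
      then have "q \<in> S" "q \<noteq> s" "q \<noteq> t" using xy nosx by auto
      then show "q \<in> S \<and> m s q = 2" using neighbour_of_endpoint[OF e mst(1) s(2)] by blast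
    qed
    then have *: "(y @ x) @ s # r \<approx> s # (y @ x) @ r" for r
      using s(1) by (intro ceq_move_front)
    have "even (k - 1)" using odd_endpoint_weight[OF e s(3,4,2)] by simp
    then have ck: "c @ [s] = alternating s t k"
      using alternating_snoc[of s t "k - 1"] s(4) by (simp add: c_def)
    obtain r where r: "c = s # r" using s(4) unfolding c_def by (cases "k - 1") auto
    have "x @ c @ (y @ x) @ s # r @ y \<approx> x @ c @ s # (y @ x) @ r @ y"
      using ceq_append[OF *[of "r @ y"], of "x @ c" "[]"] by simp
    moreover have "v @ v = x @ c @ (y @ x) @ s # r @ y"
      unfolding v(1) c_def[symmetric] by (simp add: r)
    moreover have "x @ c @ s # (y @ x) @ r @ y = x @ alternating s t k @ ((y @ x) @ r @ y)"
      unfolding ck[symmetric] by simp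
    ultimately have "v @ v \<approx> x @ alternating s t k @ ((y @ x) @ r @ y)" by (simp only:)
    with local_FC_not_braid[OF vv s] show False by blast
  next
    assume e: "odd_endpoint S m t"
    have *: "\<forall>q\<in>set (y @ x). q \<in> S \<and> m t q = 2"
    proof
      fix q assume q: "q \<in> set (y @ x)"
      then have "q \<in> S" "q \<noteq> s" "q \<noteq> t" using xy nosx by auto
      then show "q \<in> S \<and> m t q = 2" using neighbour_of_endpoint[OF e mst(2) s(1)] by blast
    qed
    have odd: "odd k" using odd_endpoint_weight[OF e mst(3) s(4,1)] .
    have k: "k - 1 = Suc (k - 2)" using s(4) by simp
    have ck: "t # c = alternating t s k" using s(4) by (cases k) (simp_all add: c_def)
    define r where "r = alternating s t (k - 2)"
    have "odd (k - 2)" using odd s(4) by simp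
    then have r: "c = r @ [t]" unfolding c_def r_def k alternating_snoc by simp
    have "(x @ r) @ t # (y @ x) \<approx> (x @ r) @ (y @ x) @ [t]"
      using s(2) * by (rule ceq_move_back)
    from ceq_append[OF this, of "[]" "c @ y"]
    have "x @ r @ t # (y @ x) @ c @ y \<approx> (x @ r @ y @ x) @ (t # c) @ y" by simp
    moreover have "v @ v = x @ r @ t # (y @ x) @ c @ y"
      unfolding v(1) c_def[symmetric] using r by simp
    ultimately have "v @ v \<approx> (x @ r @ y @ x) @ alternating t s k @ y" unfolding ck by (simp only:)
    with local_FC_not_braid[OF vv s(2,1) mst(3) s(4)] show False by blast
  qed
qed

lemma window_local_FC_of_power:
  assumes "\<And>k. k \<ge> 1 \<Longrightarrow> local_FC (concat (replicate k u))" "u \<noteq> []"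
  shows "local_FC (window u i l)"
proof -
  \<comment> \<open>Pads the window on the right to a whole number of periods.\<close>
  define r where "r = (i + l + 1) * length u - (i + l)"
  have "i + l \<le> (i + l + 1) * length u" using assms(2) by (cases u) auto
  then have "(i + l + 1) * length u = i + (l + r)" by (simp add: r_def)
  then have "concat (replicate (i + l + 1) u) = window u 0 i @ window u (0 + i) l @ window u (0 + i + l) r"
    using window_power[of u "i + l + 1"] by (simp only: window_append)
  then have "local_FC (window u 0 i @ window u (0 + i) l @ window u (0 + i + l) r)"
    using assms(1)[of "i + l + 1"] by simp
  from local_FC_factor[OF this] show ?thesis by simp
qed

text \<open>The band may live in another expression \<open>u0\<close>, but \<open>u0\<close> is
  commutation equivalent to \<open>u\<close>, so its powers satisfy \<open>local_FC\<close> too;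
  they contain two periods of the rotation carrying the band.\<close>

lemma has_band_not_all_powers:
  assumes "has_band W S m w" "supp W S w = S" "red u" "val u = w" "set u = S"
    and fc: "\<And>k. k \<ge> 1 \<Longrightarrow> local_FC (concat (replicate k u))"
  shows False
proof -
  have u: "local_FC u" using fc[of 1] by simp
  obtain s t where "has_st_band W S m w s t" using assms(1) unfolding has_band_def by blast
  note band = this[unfolded has_st_band_def assms(2) reduced_expression_iff]
  have st: "s \<in> S" "t \<in> S" "s \<noteq> t" and odd: "odd_endpoint S m s \<longleftrightarrow> \<not> odd_endpoint S m t"
    using band by simp_all
  from band[THEN conjunct2, THEN conjunct2, THEN conjunct2, THEN conjunct2]
  obtain k u0 u' v where ex: "m s t = enat k \<and> (red u0 \<and> val u0 = w) \<and> cyclic_shift u0 u' \<and>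
      u' \<approx> v \<and> red v \<and> sublist (alternating s t (k - 1)) v \<and>
      count_list u0 s = count_list (alternating s t (k - 1)) s \<and>
      count_list u0 t = count_list (alternating s t (k - 1)) t"
    by (elim exE) (rule that)
  then have k: "m s t = enat k" and u0: "red u0" "val u0 = w" and u': "cyclic_shift u0 u'"
    and v: "u' \<approx> v" and sub: "sublist (alternating s t (k - 1)) v"
    and cs: "count_list u0 s = count_list (alternating s t (k - 1)) s"
    and ct: "count_list u0 t = count_list (alternating s t (k - 1)) t"
    by simp_all
  have "val u0 = val u" using u0 assms(4) by simp
  then have u_u0: "u \<approx> u0" using local_FC_reduced[OF u] u0(1) by simp
  have "set u0 = S" using ceq_set[OF u_u0] assms(5) by simp
  \<comment> \<open>For smaller \<open>k\<close> the alternating word contains no \<open>t\<close>,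
    so the counts would contradict full support; commuting pairs give no band.\<close>
  have "k \<ge> 3"
  proof (rule ccontr)
    assume "\<not> k \<ge> 3"
    then consider "k - 1 = 0" | "k - 1 = 1" by linarith
    then have "t \<notin> set (alternating s t (k - 1))" using st(3) by cases auto
    then have "count_list u0 t = 0" using ct by (simp add: count_list_0_iff)
    then show False using \<open>set u0 = S\<close> st(2) by (simp add: count_list_0_iff)
  qed
  obtain i where i: "u' = rotate i u0" using u' unfolding cyclic_shift_def by blast
  obtain x y where v_eq: "v = x @ alternating s t (k - 1) @ y" using sub unfolding sublist_def by blast
  have "mset v = mset u0" using ceq_mset[OF v] i by (simp add: mset_rotate)
  then have cnt: "count_list v q = count_list u0 q" for q by (metis count_mset)
  have nos: "s \<notin> set (x @ y)" "t \<notin> set (x @ y)"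
    using cnt[of s] cnt[of t] cs ct unfolding v_eq by (simp_all add: count_list_0_iff)
  have "set v = S" using ceq_set[OF v] i \<open>set u0 = S\<close> by simp
  then have vS: "v \<in> lists S" unfolding in_lists_conv_set by simp
  have "u0 \<noteq> []" using \<open>set u0 = S\<close> st(1) by auto
  have "local_FC (window u0 i (length u0 + length u0))"
  proof (rule window_local_FC_of_power)
    fix k :: nat assume "k \<ge> 1"
    show "local_FC (concat (replicate k u0))"
      using local_FC_ceq[OF fc[OF \<open>k \<ge> 1\<close>] ceq_power[OF u_u0]] .
  qed fact
  then have "local_FC (u' @ u')"
    unfolding window_append window_period unfolding window_rotate i .
  then have "local_FC (v @ v)" using ceq_append_cong[OF v v] by (rule local_FC_ceq)
  moreover have "odd_endpoint S m s \<or> odd_endpoint S m t" using odd by blast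
  ultimately show False
    using band_not_local_FC[OF st(1,2) k \<open>k \<ge> 3\<close> _ v_eq vS nos] by blast
qed

lemma non_FC_window_band:
  assumes irr: "irreducible_system S m" and rank: "card S > 2"
    and u: "set u = S" and rot: "\<And>i. local_FC (rotate i u)"
    and nfc: "\<not> local_FC (window u i l)"
  obtains a b k j x y where "a \<in> S" "b \<in> S" "a \<noteq> b" "m a b = enat k" "k \<ge> 3" "odd k"
    "\<forall>d\<in>S. m a d \<ge> 3 \<longrightarrow> d = b" "\<exists>d\<in>S. d \<noteq> a \<and> m b d \<ge> 3"
    "rotate j u \<approx> x @ alternating a b (k - 1) @ y" "a \<notin> set (x @ y)" "b \<notin> set (x @ y)"
proof -
  define n where "n = length u"
  \<comment> \<open>Least over all positions at once, so that dropping the first or the last letter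
    leaves a factor satisfying \<open>local_FC\<close>.\<close>
  define L where "L = (LEAST l. \<exists>i. \<not> local_FC (window u i l))"
  have exL: "\<exists>i. \<not> local_FC (window u i L)"
    unfolding L_def using nfc by (intro LeastI_ex[of "\<lambda>l. \<exists>i. \<not> local_FC (window u i l)"]) blast
  have minL: "local_FC (window u i l)" if "l < L" for i l
    using not_less_Least[OF that[unfolded L_def]] by blast
  obtain i where i: "\<not> local_FC (window u i L)" using exL by blast
  have "u \<noteq> []" using u rank by auto
  have uS: "u \<in> lists S" unfolding in_lists_conv_set u by simp
  have windowS: "window u i' l' \<in> lists S" for i' l'
  proof -
    have "u ! ((i' + j) mod length u) \<in> set u" for j using \<open>u \<noteq> []\<close> by simp
    then show ?thesis unfolding in_lists_conv_set window_def u by auto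
  qed
  have "n < L"
  proof (rule ccontr)
    assume "\<not> n < L"
    then have "n = L + (n - L)" by simp
    then have "rotate i u = [] @ window u i L @ window u (i + L) (n - L)"
      using window_append[of u i L "n - L"] window_rotate[of u i] by (simp add: n_def)
    then have "local_FC ([] @ window u i L @ window u (i + L) (n - L))" using rot[of i] by simp
    from local_FC_factor[OF this] i show False by contradiction
  qed
  \<comment> \<open>The letters of \<open>M\<close> at offsets \<open>0\<close> to \<open>l\<close>
    are exactly those that recur one period later inside \<open>M\<close>.\<close>
  define l where "l = L - Suc n"
  have L: "L = l + Suc n" using \<open>n < L\<close> by (simp add: l_def)
  define M where "M = window u i L"
  have MS: "M \<in> lists S" unfolding M_def by (rule windowS)
  obtain z where z: "M \<approx> z" "forbidden z" using i MS unfolding local_FC_def M_def by blast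
  obtain x c y a b where z_eq: "z = x @ c @ y" and ab: "a \<in> S" "b \<in> S" and c: "set c = {a, b}" "hd c = a"
    and mab: "m a b \<noteq> 2" and forbidden: "forbidden c"
    and alt: "a = b \<or> (\<exists>k\<ge>3. m a b = enat k \<and> c = alternating a b k)"
    by (rule forbidden_chain[OF z(2)])
  have M: "M \<approx> x @ c @ y" using z(1) unfolding z_eq .
  have mba: "m b a \<noteq> 2" using mab m_sym[OF ab] by simp
  have maa: "m a a \<noteq> 2" "m b b \<noteq> 2" using m_self ab by auto
  have nc: "m q r \<noteq> 2" if "q \<in> set c" "r \<in> set c" for q r
    using that mab mba maa unfolding c(1) by auto
  have min: "\<not> window u i' (l + n) \<approx> x' @ c @ y'" for i' x' y'
  proof
    assume "window u i' (l + n) \<approx> x' @ c @ y'"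
    moreover have "local_FC (window u i' (l + n))" using L by (intro minL) simp
    ultimately have "\<not> forbidden (x' @ c @ y')" unfolding local_FC_def by blast
    with forbidden_append[OF forbidden] show False by blast
  qed
  have M_first: "M = u ! (i mod n) # window u (Suc i) (l + n)"
    unfolding M_def L n_def using window_Suc[of u i "l + length u"] by simp
  have P: "u ! (i mod n) # window u (Suc i) (l + n) \<approx> x @ c @ y"
    "u ! (i mod n) # window u (Suc i) (l + n) \<in> lists S"
    using M MS unfolding M_first .
  have ui: "u ! (i mod n) = a"
    using peel_first(1)[OF P nc min] c(2) by simp
  have x: "\<forall>q\<in>set x. m a q = 2"
    using peel_first(3)[OF P nc min] unfolding ui .
  define e where "e = u ! ((i + l) mod n)"
  have "(i + (l + n)) mod n = (i + l) mod n" using mod_add_self2[of "i + l" n] by (simp add: ac_simps)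
  then have M_last: "M = window u i (l + n) @ [e]"
    unfolding M_def L e_def using window_snoc[of u i "l + n"] by (simp add: n_def)
  have Q: "window u i (l + n) @ [e] \<approx> x @ c @ y" "window u i (l + n) @ [e] \<in> lists S"
    using M MS unfolding M_last .
  have e: "last c = e" "e \<in> set c" "\<forall>q\<in>set y. m e q = 2"
    using peel_last[OF Q nc min] by simp_all
  have eS: "e \<in> S" using e(2) c(1) ab by auto
  \<comment> \<open>All letters of \<open>x\<close> commute with \<open>a\<close>, and neither
    \<open>a\<close> nor \<open>b\<close> does; likewise for \<open>y\<close> and
    \<open>e\<close>.\<close>
  have ax: "q \<notin> set x" if "q \<in> {a, b}" for q using x that mab maa by auto
  have ey: "q \<notin> set y" if "q \<in> {a, b}" for q using e(3) that nc[OF e(2)] c(1) by auto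
  have recur: "\<exists>p q r. M = p @ f # q @ f # r \<and> set (f # q) = S"
    if f: "f = u ! ((i + j) mod n)" "j \<le> l" for f j
  proof -
    have "j + Suc (length u) \<le> L" using f(2) L by (simp add: n_def)
    then obtain p q r where "window u i L = p @ f # q @ f # r" "set (f # q) = set u"
      by (rule window_recurrence[OF \<open>u \<noteq> []\<close> _ f(1)[unfolded n_def]])
    then have "M = p @ f # q @ f # r \<and> set (f # q) = S" unfolding M_def u ..
    then show ?thesis by blast
  qed
  \<comment> \<open>A \<open>d\<close> between the first \<open>a\<close> and its recurrence stays
    before an \<open>a\<close> in \<open>x @ c @ y\<close>. Being outside \<open>x\<close> and
    \<open>c\<close>, it lies in \<open>y\<close>, and then so does that \<open>a\<close>.\<close>
  have nb_a: "d = b" if d: "d \<in> S" "m a d \<ge> 3" for d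
  proof (rule ccontr)
    assume "d \<noteq> b"
    have da: "d \<noteq> a" "m a d \<noteq> 2" using m_ge_3_iff[OF ab(1) d(1)] d(2) by auto
    have "a = u ! ((i + 0) mod n)" using ui by simp
    from recur[OF this] obtain p q r where pqr: "M = p @ a # q @ a # r" "set (a # q) = S" by blast
    have "d \<in> set q" using pqr(2) d(1) da(1) by auto
    then obtain q1 q2 where "q = q1 @ d # q2" by (meson split_list)
    then have "M = (p @ a # q1) @ d # (q2 @ a # r)" using pqr(1) by simp
    moreover have "subseq [d, a] ((p @ a # q1) @ d # (q2 @ a # r))"
      by (rule subseq_ConsI, rule subseq_ConsI) simp
    ultimately have "subseq [d, a] M" by (simp only:)
    then have "subseq [d, a] (x @ c @ y)"
      using ceq_subseq[OF M ab(1) d(1) da(2)] by simp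
    moreover have "d \<notin> set (x @ c)" using x da \<open>d \<noteq> b\<close> c(1) by auto
    ultimately have "subseq [d, a] y" using subseq_Cons_skip[of d "[a]" "x @ c" y] by simp
    from subseq_set[OF this] have "a \<in> set y" by simp
    then show False using ey by simp
  qed
  \<comment> \<open>The mirror image at the end of \<open>M\<close>; whether \<open>e\<close> is
    \<open>a\<close> or \<open>b\<close> is still open.\<close>
  have nb_e: "d \<in> {a, b}" if d: "d \<in> S" "m e d \<ge> 3" for d
  proof (rule ccontr)
    assume dab: "d \<notin> {a, b}"
    have de: "d \<noteq> e" "m e d \<noteq> 2" using m_ge_3_iff[OF eS d(1)] d(2) by auto
    from recur[OF e_def] obtain p q r where pqr: "M = p @ e # q @ e # r" "set (e # q) = S" by blast
    have "d \<in> set q" using pqr(2) d(1) de(1) by auto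
    then obtain q1 q2 where "q = q1 @ d # q2" by (meson split_list)
    then have "M = p @ e # (q1 @ d # (q2 @ e # r))" using pqr(1) by simp
    moreover have "subseq [e, d] (p @ e # (q1 @ d # (q2 @ e # r)))"
      by (rule subseq_ConsI, rule subseq_ConsI) simp
    ultimately have "subseq [e, d] M" by (simp only:)
    then have "subseq [e, d] (x @ c @ y)"
      using ceq_subseq[OF M eS d(1) de(2)] by simp
    moreover have "e \<notin> set x" using ax e(2) c(1) by blast
    ultimately have "subseq [e, d] (c @ y)" by (rule subseq_Cons_skip)
    from subseq_set[OF this] have "d \<in> set (c @ y)" by simp
    then have "d \<in> set y" using dab c(1) by auto
    then show False using e(3) de(2) by simp
  qed
  have "\<not> S \<subseteq> {a, b}"
  proof
    assume "S \<subseteq> {a, b}"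
    then have "card S \<le> card {a, b}" by (intro card_mono) auto
    also have "\<dots> \<le> 2" by (simp add: card_insert_if)
    finally show False using rank by simp
  qed
  then obtain t where t: "t \<in> S" "t \<notin> {a, b}" by blast
  have "{a, b} \<subseteq> S" "a \<in> {a, b}" using ab by simp_all
  \<comment> \<open>The edge leaving \<open>{a, b}\<close> starts neither at \<open>a\<close> nor at
    \<open>e\<close>, so it starts at \<open>b\<close>, and \<open>b\<close> differs from
    both.\<close>
  then obtain f d where fd: "f \<in> {a, b}" "d \<in> S" "d \<notin> {a, b}" "m f d \<ge> 3"
    by (rule edge_out[OF irr _ _ t])
  have "f \<noteq> a" using nb_a fd by auto
  then have f: "f = b" "a \<noteq> b" using fd(1) by auto
  have "e \<noteq> b" using nb_e fd f by auto
  then have "e = a" using e(2) c(1) by auto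
  obtain k where k: "k \<ge> 3" "m a b = enat k" "c = alternating a b k" using alt f(2) by blast
  have "odd k"
  proof (rule ccontr)
    assume "\<not> odd k"
    then obtain k' where "k = Suc k'" "odd k'" using k(1) by (cases k) auto
    then have "c = alternating a b k' @ [b]" unfolding k(3) by (simp only: alternating_snoc) simp
    then show False using e(1) \<open>e \<noteq> b\<close> by simp
  qed
  \<comment> \<open>Otherwise alternation puts a \<open>b\<close> between the recurrence of the
    first \<open>a\<close> and the final \<open>a\<close>. This \<open>b\<close> also occurs one
    period earlier, with \<open>d\<close> in between; as \<open>d\<close> can only lie in
    \<open>y\<close>, the later \<open>b\<close> would too.\<close>
  have "l = 0"
  proof (rule ccontr)
    assume "l \<noteq> 0"
    then obtain l' where l': "l = Suc l'" by (cases l) auto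
    let ?P = "\<lambda>x. x = a \<or> x = b"
    have "filter ?P M = filter ?P (x @ c @ y)" using ceq_filter[OF M ab mab] .
    also have "\<dots> = c"
    proof -
      have "filter ?P x = []" "filter ?P y = []" using ax ey by (auto simp: filter_empty_conv)
      moreover have "filter ?P c = c" using c(1) by (auto intro!: filter_True)
      ultimately show ?thesis by simp
    qed
    finally have filter_M: "filter ?P M = c" .
    define B where "B = window u (Suc i) l"
    obtain n' where n': "n = Suc n'" using \<open>u \<noteq> []\<close> by (cases u) (auto simp: n_def)
    have "L = n + Suc l" using L by simp
    then have "M = window u i n @ window u (i + n) (Suc l)" unfolding M_def by (simp only: window_append)
    also have "window u (i + n) (Suc l) = a # B"
      unfolding n_def window_period using ui by (simp add: window_Suc B_def n_def)
    finally have M_B: "M = window u i n @ a # B" .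
    have "last M = a" unfolding M_last using \<open>e = a\<close> by simp
    moreover have "B \<noteq> []" unfolding B_def l' window_Suc by simp
    ultimately have "last B = a" unfolding M_B by simp
    have "b \<in> set B"
    proof (rule ccontr)
      assume "b \<notin> set B"
      have "a \<in> set (filter ?P B)" using \<open>last B = a\<close> last_in_set[OF \<open>B \<noteq> []\<close>] by simp
      then obtain g gs where g: "filter ?P B = g # gs" by (cases "filter ?P B") auto
      then have "g \<in> set (filter ?P B)" by simp
      then have "g = a" using \<open>b \<notin> set B\<close> by auto
      then have "alternating a b k = filter ?P (window u i n) @ [a, a] @ gs"
        using filter_M g unfolding k(3) M_B by simp
      from alternating_adjacent[OF this f(2)] show False by simp
    qed
    then obtain j where j: "j < l" "b = B ! j" by (auto simp: in_set_conv_nth B_def)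
    then have "b = u ! ((i + Suc j) mod n)" by (simp add: B_def window_def n_def)
    from recur[OF this] j(1) obtain p q r where pqr: "M = p @ b # q @ b # r" "set (b # q) = S"
      using Suc_leI by blast
    have db: "d \<noteq> b" "m b d \<noteq> 2" using m_ge_3_iff[OF ab(2) fd(2)] fd(4) f(1) by auto
    have "d \<in> set q" using pqr(2) fd(2) db(1) by auto
    then obtain q1 q2 where "q = q1 @ d # q2" by (meson split_list)
    then have "M = p @ b # (q1 @ d # (q2 @ b # r))" using pqr(1) by simp
    moreover have "subseq [b, d, b] (p @ b # (q1 @ d # (q2 @ b # r)))"
      by (rule subseq_ConsI, rule subseq_ConsI, rule subseq_ConsI) simp
    ultimately have "subseq [b, d, b] M" by (simp only:)
    then have "subseq [b, d, b] (x @ c @ y)"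
      using ceq_subseq[OF M ab(2) fd(2) db(2)] by simp
    moreover have "b \<notin> set x" using ax by simp
    ultimately have "subseq [b, d, b] (c @ y)" by (rule subseq_Cons_skip)
    then have "subseq [d, b] (c @ y)" by (rule subseq_Cons')
    moreover have "d \<notin> set c" using fd(3) c(1) by simp
    ultimately have "subseq [d, b] y" by (rule subseq_Cons_skip)
    from subseq_set[OF this] have "b \<in> set y" by simp
    then show False using ey by simp
  qed
  have k1: "k = Suc (k - 1)" using k(1) by simp
  have "even (k - 1)" using \<open>odd k\<close> by simp
  then have c_eq: "c = alternating a b (k - 1) @ [a]"
    using alternating_snoc[of a b "k - 1"] k1 k(3) by simp
  have M_R: "M = rotate i u @ [a]"
    using M_last \<open>l = 0\<close> \<open>e = a\<close> window_rotate[of u i] by (simp add: n_def)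
  have yS: "set y \<subseteq> S" using ceq_lists[OF M] MS by auto
  \<comment> \<open>The final \<open>a\<close> of the braid commutes with \<open>y\<close>, so it
    moves to the end and cancels against the last letter of \<open>M\<close>.\<close>
  have "(x @ alternating a b (k - 1)) @ a # y \<approx> (x @ alternating a b (k - 1)) @ y @ [a]"
    using ab(1) e(3) yS \<open>e = a\<close> by (intro ceq_move_back) auto
  then have "rotate i u @ [a] \<approx> (x @ alternating a b (k - 1) @ y) @ [a]"
    using M unfolding M_R c_eq by (simp add: ceq_trans)
  then have R: "rotate i u \<approx> x @ alternating a b (k - 1) @ y"
    using MS unfolding M_R by (rule ceq_cancel_snoc)
  show ?thesis
  proof (rule that[OF ab f(2) k(2,1) \<open>odd k\<close> _ _ R])
    show "\<forall>d\<in>S. m a d \<ge> 3 \<longrightarrow> d = b" using nb_a by blast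
    show "\<exists>d\<in>S. d \<noteq> a \<and> m b d \<ge> 3" using fd f by auto
    show "a \<notin> set (x @ y)" "b \<notin> set (x @ y)" using ax ey by auto
  qed
qed

text \<open>\<open>b\<close> is the only neighbour of \<open>a\<close> and the weight is odd, so
  \<open>a\<close> is an odd endpoint; \<open>b\<close> has a second neighbour, so it is
  none.\<close>

lemma has_bandI:
  assumes ab: "a \<in> S" "b \<in> S" "a \<noteq> b" "m a b = enat k" "k \<ge> 3" "odd k"
    and nb: "\<forall>d\<in>S. m a d \<ge> 3 \<longrightarrow> d = b" and ex: "\<exists>d\<in>S. d \<noteq> a \<and> m b d \<ge> 3"
    and R: "rotate j u \<approx> x @ alternating a b (k - 1) @ y"
    and no: "a \<notin> set (x @ y)" "b \<notin> set (x @ y)" and fc: "local_FC (rotate j u)"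
    and u: "red u" "val u = w" "supp W S w = S"
  shows "has_band W S m w"
proof -
  define c where "c = alternating a b (k - 1)"
  have mab: "m a b \<ge> 3" "m b a \<ge> 3" using ab m_sym[OF ab(1,2)] by (simp_all add: numeral_eq_enat)
  have edge: "(a, b) \<in> coxeter_graph S m" using ab(1,2) mab(1) by (simp add: coxeter_graph_def)
  have "d = b" if "(a, d) \<in> coxeter_graph S m" for d
    using that nb unfolding coxeter_graph_def by simp
  then have "coxeter_graph S m `` {a} = {b}" using edge by blast
  then have "card (coxeter_graph S m `` {a}) = 1" by simp
  then have a: "odd_endpoint S m a"
    unfolding odd_endpoint_def endpoint_def using ab(1,4,6) edge by blast
  have b: "\<not> odd_endpoint S m b"
  proof
    assume e: "odd_endpoint S m b"
    obtain d where d: "d \<in> S" "d \<noteq> a" "m b d \<ge> 3" using ex by blast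
    then have "d \<noteq> b" "m b d \<noteq> 2" using m_ge_3_iff[OF ab(2) d(1)] by auto
    then show False using neighbour_of_endpoint[OF e mab(2) ab(1) d(1) _ d(2)] by simp
  qed
  have "mset u = mset (x @ c @ y)" using ceq_mset[OF R] by (simp add: mset_rotate c_def)
  then have cnt: "count_list u q = count_list (x @ c @ y) q" for q by (metis count_mset)
  have "count_list x a = 0" "count_list x b = 0" "count_list y a = 0" "count_list y b = 0"
    using no by (simp_all add: count_list_0_iff)
  then have count: "count_list u a = count_list c a" "count_list u b = count_list c b"
    unfolding cnt by simp_all
  have red: "red (x @ c @ y)" using local_FC_reduced[OF local_FC_ceq[OF fc R]] unfolding c_def by simp
  have shift: "cyclic_shift u (rotate j u)" unfolding cyclic_shift_def by (rule exI) (rule refl)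
  have sub: "sublist c (x @ c @ y)" by (rule sublist_appendI)
  note R = R[folded c_def]
  have "\<exists>k u' v' v. m a b = enat k \<and> (red u' \<and> val u' = w) \<and> cyclic_shift u' v' \<and> v' \<approx> v \<and>
      red v \<and> sublist (alternating a b (k - 1)) v \<and>
      count_list u' a = count_list (alternating a b (k - 1)) a \<and>
      count_list u' b = count_list (alternating a b (k - 1)) b"
    by (rule exI[of _ k], rule exI[of _ u], rule exI[of _ "rotate j u"], rule exI[of _ "x @ c @ y"],
        fold c_def, intro conjI) (rule ab(4) u(1,2) shift R red sub count)+
  then have "has_st_band W S m w a b"
    unfolding has_st_band_def u(3) reduced_expression_iff using ab(1-3) a b by simp
  then show ?thesis unfolding has_band_def by blast
qed

lemma powers_FC_iff_no_band:
  assumes irr: "irreducible_system S m" and rank: "card S > 2"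
    and w: "w \<in> CFC W S m" and u: "reduced_expression_for W S u w" and sp: "supp W S w = S"
  shows "(\<forall>k::nat. k \<ge> 1 \<longrightarrow> FC_word W S m (concat (replicate k u))) \<longleftrightarrow> \<not> has_band W S m w"
proof -
  have ru: "red u" "val u = w" using u unfolding reduced_expression_iff by auto
  have rot: "local_FC (rotate i u)" for i
    using w u unfolding CFC_def cyclic_shift_def FC_word_iff by blast
  then have fu: "local_FC u" using rot[of 0] by simp
  have "set u = S"
  proof
    show "set u \<subseteq> S" using red_lists[OF ru(1)] by auto
    show "S \<subseteq> set u"
    proof
      fix s assume "s \<in> S"
      then obtain v where v: "red v" "val v = w" "s \<in> set v"
        using sp unfolding supp_def reduced_expression_iff by blast
      have "val v = val u" using v(2) ru(2) by simp
      then have "u \<approx> v" using local_FC_reduced[OF fu] v(1) by simp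
      then show "s \<in> set u" using ceq_set v(3) by blast
    qed
  qed
  show ?thesis unfolding FC_word_iff
  proof
    assume "\<forall>k::nat. k \<ge> 1 \<longrightarrow> local_FC (concat (replicate k u))"
    then show "\<not> has_band W S m w"
      using has_band_not_all_powers[OF _ sp ru \<open>set u = S\<close>] by blast
  next
    assume nb: "\<not> has_band W S m w"
    have "local_FC (window u i l)" for i l
    proof (rule ccontr)
      assume nfc: "\<not> local_FC (window u i l)"
      obtain a b k j x y where "a \<in> S" "b \<in> S" "a \<noteq> b" "m a b = enat k" "k \<ge> 3" "odd k"
        "\<forall>d\<in>S. m a d \<ge> 3 \<longrightarrow> d = b" "\<exists>d\<in>S. d \<noteq> a \<and> m b d \<ge> 3"
        "rotate j u \<approx> x @ alternating a b (k - 1) @ y" "a \<notin> set (x @ y)" "b \<notin> set (x @ y)"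
        by (rule non_FC_window_band[OF irr rank \<open>set u = S\<close> rot nfc])
      then have "has_band W S m w" by (rule has_bandI) (rule rot ru sp)+
      with nb show False by contradiction
    qed
    then have "local_FC (window u 0 (k * length u))" for k .
    then show "\<forall>k::nat. k \<ge> 1 \<longrightarrow> local_FC (concat (replicate k u))"
      unfolding window_power by blast
  qed
qed

end

theorem theorem4p9:
  fixes W :: "('g, 'b) monoid_scheme" and S :: "'g set" and m :: "'g \<Rightarrow> 'g \<Rightarrow> enat"
    and u :: "'g list" and w :: 'g
  assumes "coxeter_system W S m"
    and "irreducible_system S m"
    and "card S > 2"
    and "w \<in> CFC W S m"
    and "reduced_expression_for W S u w"
    and "supp W S w = S"
  shows "(\<forall>k::nat. k \<ge> 1 \<longrightarrow> FC_word W S m (concat (replicate k u))) \<longleftrightarrow> \<not> has_band W S m w"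
  using coxeter_system.powers_FC_iff_no_band[OF assms] .

end
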